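(* Assume that the ALS parameter sequence $(\mathbf p_k)_{k\in\mathbb N}$ satisfies assumption (A2) below. Then every accumulation point of the sequence $(v_k)_{k\in\mathbb N}$ of represented tensors belongs to the set $\mathfrak M$ of critical points, and $$\operatorname{dist}(v_k,\mathfrak M):=\inf_{w\in\mathfrak M}\|v_k-w\|\xrightarrow[k\to\infty]{}0 .$$
   Context: Let $d\ge 1$ and $m_1,\dots,m_d$ be positive integers, $N=\prod_{\nu=1}^d m_\nu$, and $\mathcal V=\bigotimes_{\nu=1}^d\mathbb R^{m_\nu}\cong\mathbb R^N$ with the Euclidean inner product $\langle\cdot,\cdot\rangle$ and norm $\|\cdot\|$. Let $A\in\mathbb R^{N\times N}$ be symmetric positive definite and $b\in\mathcal V\setminus\{0\}$; put $f(v)=\frac{1}{\|b\|^2}\big(\tfrac12\langle Av,v\rangle-\langle b,v\rangle\big)$. A tensor format representation consists of an integer $L\ge d$, finite-dimensional real inner product spaces $P_1,\dots,P_L$, the parameter space $P=P_1\times\dots\times P_L$ (with product inner product and norm), and a multilinear map $U:P\to\mathcal V$; put $F=f\circ U$. For $\mathbf p=(p_1,\dots,p_L)\in P$ and $\mu\in\{1,\dots,L\}$ let $\mathbf p^{[\mu]}=(p_1,\dots,p_{\mu-1},p_{\mu+1},\dots,p_L)$ and let $W_{\mu,\mathbf p^{[\mu]}}:P_\mu\to\mathcal V$ be the linear map $q\mapsto U(p_1,\dots,p_{\mu-1},q,p_{\mu+1},\dots,p_L)$. Linear maps are identified with matrices w.r.t. fixed orthonormal bases; $X^T$ is the transpose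 (adjoint), $X^+$ the Moore–Penrose pseudoinverse. ALS: choose $\mathbf p_1=(p_1^1,\dots,p_L^1)\in P$. For $k=1,2,\dots$ and $\mu=1,\dots,L$ in this order let $W_{k,\mu}:=W_{\mu,(p_1^{k+1},\dots,p_{\mu-1}^{k+1},p_{\mu+1}^k,\dots,p_L^k)}$, $G_{k,\mu}:=W_{k,\mu}^TAW_{k,\mu}$ and $p_\mu^{k+1}:=G_{k,\mu}^+W_{k,\mu}^Tb$ (the minimum-norm minimiser of $q\mapsto F(p_1^{k+1},\dots,p_{\mu-1}^{k+1},q,p_{\mu+1}^k,\dots,p_L^k)$). Put $\mathbf p_k=(p_1^k,\dots,p_L^k)$, $v_k=U(\mathbf p_k)$, and for $\mu\in\{0,\dots,L\}$, $\mathbf p_{k,\mu}=(p_1^{k+1},\dots,p_\mu^{k+1},p_{\mu+1}^k,\dots,p_L^k)$. Critical points: $\mathfrak M=\{v\in\mathcal V:\exists\,\mathbf p\in P \text{ with } v=U(\mathbf p)\text{ and } F'(\mathbf p)=0\}$. Assumption (A2): $(\mathbf p_k)_k$ is bounded, and for every infinite $J\subseteq\mathbb N$ the following holds: let $\mathrm{Ap}_J$ be the set of all accumulation points of the sequences $(\mathbf p_{k,\mu})_{k\in J}$, $\mu=0,\dots,L-1$, and let $\mathbf p^*=(p_1^*,\dots,p_L^* )\in\mathrm{Ap}_J$ be an element of minimal norm in $\mathrm{Ap}_J$; then for every $\mu\in\{1,\dots,L\}$ there is $k_0\in J$ such that $\operatorname{rank}W_{k,\mu}=\operatorname{rank}W_{\mu,\mathbf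 p^{*[\mu]}}$ for all $k\in J$ with $k\ge k_0$. *)

theory Defs
  imports "HOL-Analysis.Analysis"
begin

text \<open>Parameters: a parameter p = (p_1,...,p_L) is a function nat => 'p with
  p mu in the subspace S mu (the space P_mu) for mu in {1..L}, and p mu = 0 otherwise.\<close>

definition param_space :: "nat \<Rightarrow> (nat \<Rightarrow> 'p::real_vector set) \<Rightarrow> (nat \<Rightarrow> 'p) set" where
  "param_space L S = {p. (\<forall>\<mu>\<in>{1..L}. p \<mu> \<in> S \<mu>) \<and> (\<forall>\<mu>. \<mu> \<notin> {1..L} \<longrightarrow> p \<mu> = 0)}"

definition pnorm :: "nat \<Rightarrow> (nat \<Rightarrow> 'p::real_normed_vector) \<Rightarrow> real" where
  "pnorm L p = sqrt (\<Sum>\<mu>=1..L. (norm (p \<mu>))\<^sup>2)"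

definition lin_on :: "'a::real_vector set \<Rightarrow> ('a \<Rightarrow> 'b::real_vector) \<Rightarrow> bool" where
  "lin_on S T \<longleftrightarrow> (\<forall>x\<in>S. \<forall>y\<in>S. T (x + y) = T x + T y) \<and> (\<forall>c. \<forall>x\<in>S. T (c *\<^sub>R x) = c *\<^sub>R T x)"

definition adjoint_on :: "'a::real_inner set \<Rightarrow> ('a \<Rightarrow> 'b::real_inner) \<Rightarrow> 'b \<Rightarrow> 'a" where
  "adjoint_on S T v = (THE u. u \<in> S \<and> (\<forall>q\<in>S. u \<bullet> q = T q \<bullet> v))"

text \<open>Moore-Penrose pseudoinverse of a linear map T defined on S, applied to y:
  the minimum-norm least-squares solution.\<close>
definition pinv_on :: "'a::real_normed_vector set \<Rightarrow> ('a \<Rightarrow> 'b::real_normed_vector) \<Rightarrow> 'b \<Rightarrow> 'a" where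
  "pinv_on S T y = (THE x. x \<in> S \<and> (\<forall>z\<in>S. norm (T x - y) \<le> norm (T z - y)) \<and>
      (\<forall>z\<in>S. (\<forall>w\<in>S. norm (T z - y) \<le> norm (T w - y)) \<longrightarrow> norm x \<le> norm z))"

definition Wmap :: "((nat \<Rightarrow> 'p) \<Rightarrow> 'v) \<Rightarrow> nat \<Rightarrow> (nat \<Rightarrow> 'p) \<Rightarrow> 'p \<Rightarrow> 'v" where
  "Wmap U \<mu> p = (\<lambda>q. U (p(\<mu> := q)))"

definition ffun :: "('v::real_inner \<Rightarrow> 'v) \<Rightarrow> 'v \<Rightarrow> 'v \<Rightarrow> real" where
  "ffun A b v = (1 / (norm b)\<^sup>2) * ((1/2) * (A v \<bullet> v) - b \<bullet> v)"

text \<open>F'(p) = 0 for F = f o U (derivative in every direction h of P vanishes).\<close>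
definition is_crit :: "nat \<Rightarrow> (nat \<Rightarrow> 'p::real_vector set) \<Rightarrow> ((nat \<Rightarrow> 'p) \<Rightarrow> 'v::real_inner)
    \<Rightarrow> ('v \<Rightarrow> 'v) \<Rightarrow> 'v \<Rightarrow> (nat \<Rightarrow> 'p) \<Rightarrow> bool" where
  "is_crit L S U A b p \<longleftrightarrow> (\<forall>h\<in>param_space L S.
     ((\<lambda>t. ffun A b (U (\<lambda>\<nu>. p \<nu> + t *\<^sub>R h \<nu>))) has_real_derivative 0) (at 0))"

definition crit_set :: "nat \<Rightarrow> (nat \<Rightarrow> 'p::real_vector set) \<Rightarrow> ((nat \<Rightarrow> 'p) \<Rightarrow> 'v::real_inner)
    \<Rightarrow> ('v \<Rightarrow> 'v) \<Rightarrow> 'v \<Rightarrow> 'v set" where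
  "crit_set L S U A b = {v. \<exists>p\<in>param_space L S. v = U p \<and> is_crit L S U A b p}"

definition als_mix :: "(nat \<Rightarrow> nat \<Rightarrow> 'p) \<Rightarrow> nat \<Rightarrow> nat \<Rightarrow> nat \<Rightarrow> 'p" where
  "als_mix pk k \<mu> = (\<lambda>\<nu>. if 1 \<le> \<nu> \<and> \<nu> \<le> \<mu> then pk (Suc k) \<nu> else pk k \<nu>)"

definition als_W :: "((nat \<Rightarrow> 'p) \<Rightarrow> 'v) \<Rightarrow> (nat \<Rightarrow> nat \<Rightarrow> 'p) \<Rightarrow> nat \<Rightarrow> nat \<Rightarrow> 'p \<Rightarrow> 'v" where
  "als_W U pk k \<mu> = Wmap U \<mu> (als_mix pk k (\<mu> - 1))"

definition als_G :: "(nat \<Rightarrow> 'p::real_inner set) \<Rightarrow> ((nat \<Rightarrow> 'p) \<Rightarrow> 'v::real_inner) \<Rightarrow> ('v \<Rightarrow> 'v)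
    \<Rightarrow> (nat \<Rightarrow> nat \<Rightarrow> 'p) \<Rightarrow> nat \<Rightarrow> nat \<Rightarrow> 'p \<Rightarrow> 'p" where
  "als_G S U A pk k \<mu> = (\<lambda>q. adjoint_on (S \<mu>) (als_W U pk k \<mu>) (A (als_W U pk k \<mu> q)))"

definition is_ALS_seq :: "nat \<Rightarrow> (nat \<Rightarrow> 'p::real_inner set) \<Rightarrow> ((nat \<Rightarrow> 'p) \<Rightarrow> 'v::real_inner)
    \<Rightarrow> ('v \<Rightarrow> 'v) \<Rightarrow> 'v \<Rightarrow> (nat \<Rightarrow> nat \<Rightarrow> 'p) \<Rightarrow> bool" where
  "is_ALS_seq L S U A b pk \<longleftrightarrow>
     (\<forall>k\<ge>1. pk k \<in> param_space L S) \<and>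
     (\<forall>k\<ge>1. \<forall>\<mu>\<in>{1..L}. pk (Suc k) \<mu> =
        pinv_on (S \<mu>) (als_G S U A pk k \<mu>) (adjoint_on (S \<mu>) (als_W U pk k \<mu>) b))"

definition acc_point_on :: "nat \<Rightarrow> nat set \<Rightarrow> (nat \<Rightarrow> nat \<Rightarrow> 'p::real_normed_vector) \<Rightarrow> (nat \<Rightarrow> 'p) \<Rightarrow> bool" where
  "acc_point_on L J x c \<longleftrightarrow> (\<forall>\<epsilon>>0. infinite {k\<in>J. pnorm L (\<lambda>\<nu>. x k \<nu> - c \<nu>) < \<epsilon>})"

definition Ap_set :: "nat \<Rightarrow> (nat \<Rightarrow> 'p::real_normed_vector set) \<Rightarrow> (nat \<Rightarrow> nat \<Rightarrow> 'p) \<Rightarrow> nat set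
    \<Rightarrow> (nat \<Rightarrow> 'p) set" where
  "Ap_set L S pk J = {c. c \<in> param_space L S \<and>
      (\<exists>\<mu>\<in>{0..<L}. acc_point_on L J (\<lambda>k. als_mix pk k \<mu>) c)}"

definition assumption_A2 :: "nat \<Rightarrow> (nat \<Rightarrow> 'p::euclidean_space set) \<Rightarrow> ((nat \<Rightarrow> 'p) \<Rightarrow> 'v::euclidean_space)
    \<Rightarrow> (nat \<Rightarrow> nat \<Rightarrow> 'p) \<Rightarrow> bool" where
  "assumption_A2 L S U pk \<longleftrightarrow>
     (\<exists>C. \<forall>k\<ge>1. pnorm L (pk k) \<le> C) \<and>
     (\<forall>J. infinite J \<and> J \<subseteq> {1..} \<longrightarrow>
        (\<forall>ps\<in>Ap_set L S pk J. (\<forall>q\<in>Ap_set L S pk J. pnorm L ps \<le> pnorm L q) \<longrightarrow>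
           (\<forall>\<mu>\<in>{1..L}. \<exists>k0\<in>J. \<forall>k\<in>J. k \<ge> k0 \<longrightarrow>
               dim (als_W U pk k \<mu> ` S \<mu>) = dim (Wmap U \<mu> ps ` S \<mu>))))"

end

theory Submission
  imports Defs
begin

text \<open>
  Each micro-step replaces the represented tensor by the \<open>A\<close>-orthogonal projection of
  \<open>A\<^sup>-\<^sup>1 b\<close> onto a subspace that contains the current tensor, so the energy decrease controls the
  increments, which therefore tend to 0; all partially updated parameters along a subsequence thus
  represent the same limit tensor \<open>w\<close>. Among all accumulation points of the partially updated
  parameters that represent \<open>w\<close> pick one, \<open>c\<close>, of minimal norm. If the parameters converge to \<open>c\<close>
  just before an update of component \<open>\<mu>\<close>, passing to the limit in the normal equations gives the
  \<open>\<mu>\<close>-th criticality condition at \<open>c\<close>. By the constant rank assumption the limit \<open>c'\<close> after the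
  update is orthogonal, in component \<open>\<mu>\<close>, to the kernel of the limit map; \<open>c\<close> and \<open>c'\<close> differ by
  an element of that kernel, so Pythagoras and the minimality of \<open>c\<close> force \<open>c' = c\<close>. Hence the
  argument repeats with the next component, and after one sweep \<open>c\<close> satisfies every criticality
  condition.
\<close>

subsection \<open>Linear maps on subspaces\<close>

text \<open>\<open>T\<close> may be arbitrary off \<open>S\<close>. Prescribing its values on a
  basis of \<open>S\<close> gives a globally linear map, and the points of \<open>S\<close> where
  the two agree form a subspace containing that basis.\<close>

lemma lin_on_extend:
  fixes T :: "'a::euclidean_space \<Rightarrow> 'b::real_vector"
  assumes S: "subspace S" and T: "lin_on S T"
  obtains g where "linear g" "\<And>x. x \<in> S \<Longrightarrow> g x = T x"
proof -
  obtain B where B: "B \<subseteq> S" "independent B" "span B = S"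
    using orthonormal_basis_subspace[OF S] by metis
  obtain g where g: "linear g" "\<forall>x\<in>B. g x = T x"
    using linear_independent_extend[OF B(2)] by blast
  have T0: "T 0 = 0"
    using T subspace_0[OF S] unfolding lin_on_def by (metis scaleR_zero_left)
  have "x \<in> S \<and> g x = T x" if "x \<in> S" for x
  proof (rule span_induct[of x B "\<lambda>x. x \<in> S \<and> g x = T x"])
    show "x \<in> span B" using that B by simp
    show "subspace {x. x \<in> S \<and> g x = T x}"
      using S T g(1) T0 unfolding lin_on_def subspace_def
      by (auto simp: linear_add linear_scale linear_0)
  qed (use B g in auto)
  with g(1) that show ?thesis by blast
qed

lemma subspace_image_lin_on:
  fixes T :: "'a::euclidean_space \<Rightarrow> 'b::real_vector"
  assumes "subspace S" "lin_on S T"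
  shows "subspace (T ` S)"
proof -
  obtain g where "linear g" "\<And>x. x \<in> S \<Longrightarrow> g x = T x"
    using lin_on_extend[OF assms] by blast
  then show ?thesis using linear_subspace_image[of g S] assms(1) by (metis image_cong)
qed

lemma lin_on_diff:
  assumes "subspace S" "lin_on S T" "x \<in> S" "y \<in> S"
  shows "T (x - y) = T x - T y"
proof -
  have "T (x + (-1) *\<^sub>R y) = T x + (-1) *\<^sub>R T y"
    using assms subspace_scale[of S y "-1"] unfolding lin_on_def by metis
  then show ?thesis by simp
qed

text \<open>The orthonormal basis is fixed before \<open>T\<close> is chosen, so one finite set
  controls a whole sequence of maps: pointwise convergence on \<open>B\<close> becomes uniform
  convergence on bounded subsets of \<open>S\<close>.\<close>

lemma lin_on_expand:
  fixes S :: "'a::euclidean_space set"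
  assumes S: "subspace S"
  obtains B where "finite B" "B \<subseteq> S" "\<And>i. i \<in> B \<Longrightarrow> norm i = 1"
    "\<And>(T :: 'a \<Rightarrow> 'b::real_vector) q. lin_on S T \<Longrightarrow> q \<in> S \<Longrightarrow> T q = (\<Sum>i\<in>B. (q \<bullet> i) *\<^sub>R T i)"
proof -
  obtain B where B: "B \<subseteq> S" "pairwise orthogonal B" "\<And>x. x \<in> B \<Longrightarrow> norm x = 1"
    "independent B" "span B = S"
    using orthonormal_basis_subspace[OF S] by metis
  have fin: "finite B" using B(4) independent_imp_finite by blast
  have "T q = (\<Sum>i\<in>B. (q \<bullet> i) *\<^sub>R T i)" if T: "lin_on S T" and q: "q \<in> S" for T :: "'a \<Rightarrow> 'b" and q
  proof -
    obtain g where g: "linear g" "\<And>x. x \<in> S \<Longrightarrow> g x = T x"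
      using lin_on_extend[OF S T] by blast
    have "g q = g (\<Sum>i\<in>B. (q \<bullet> i) *\<^sub>R i)"
      using orthonormal_basis_expand[OF B(2,3) _ fin] B(5) q by simp
    also have "\<dots> = (\<Sum>i\<in>B. (q \<bullet> i) *\<^sub>R g i)"
      by (simp add: linear_sum[OF g(1)] linear_scale[OF g(1)])
    also have "\<dots> = (\<Sum>i\<in>B. (q \<bullet> i) *\<^sub>R T i)"
      by (rule sum.cong) (use g B in auto)
    finally show ?thesis using g q by simp
  qed
  with that fin B show ?thesis by metis
qed

text \<open>The adjoint of a linear extension may leave \<open>S\<close>; its orthogonal projection
  onto \<open>S\<close> has the same inner products with vectors of \<open>S\<close>. Uniqueness
  holds because the difference of two candidates lies in \<open>S\<close> and is orthogonal to
  itself.\<close>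

lemma adjoint_on_works:
  fixes T :: "'a::euclidean_space \<Rightarrow> 'b::euclidean_space"
  assumes S: "subspace S" and T: "lin_on S T"
  shows "adjoint_on S T v \<in> S" "\<And>q. q \<in> S \<Longrightarrow> adjoint_on S T v \<bullet> q = T q \<bullet> v"
proof -
  obtain g where g: "linear g" "\<And>x. x \<in> S \<Longrightarrow> g x = T x"
    using lin_on_extend[OF S T] by blast
  obtain y z where yz: "y \<in> span S" "\<And>w. w \<in> span S \<Longrightarrow> orthogonal z w" "adjoint g v = y + z"
    using orthogonal_subspace_decomp_exists by metis
  have sp: "span S = S" using S by simp
  have y: "y \<bullet> q = T q \<bullet> v" if "q \<in> S" for q
  proof -
    have "T q \<bullet> v = q \<bullet> adjoint g v"
      using adjoint_works[OF g(1)] g(2)[OF that] by metis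
    then show ?thesis using yz(2)[of q] that sp
      by (simp add: yz(3) inner_add_right orthogonal_def inner_commute)
  qed
  have "\<exists>!u. u \<in> S \<and> (\<forall>q\<in>S. u \<bullet> q = T q \<bullet> v)"
  proof (rule ex1I[of _ y])
    show "y \<in> S \<and> (\<forall>q\<in>S. y \<bullet> q = T q \<bullet> v)" using y yz sp by auto
    fix u assume u: "u \<in> S \<and> (\<forall>q\<in>S. u \<bullet> q = T q \<bullet> v)"
    then have "u - y \<in> S" using yz sp S subspace_diff by metis
    then have "(u - y) \<bullet> (u - y) = 0" using u y by (simp add: inner_diff_left)
    then show "u = y" by simp
  qed
  then have "adjoint_on S T v \<in> S \<and> (\<forall>q\<in>S. adjoint_on S T v \<bullet> q = T q \<bullet> v)"
    unfolding adjoint_on_def by (rule theI')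
  then show "adjoint_on S T v \<in> S" "\<And>q. q \<in> S \<Longrightarrow> adjoint_on S T v \<bullet> q = T q \<bullet> v" by auto
qed

section \<open>Galerkin systems, minimum-norm solutions and limits of constant rank\<close>

lemma galerkin_solution_exists:
  fixes A :: "'v::euclidean_space \<Rightarrow> 'v"
  assumes A: "linear A" "\<And>x. x \<noteq> 0 \<Longrightarrow> A x \<bullet> x > 0" and R: "subspace R"
  obtains v where "v \<in> R" "\<And>u. u \<in> R \<Longrightarrow> u \<bullet> (A v - b) = 0"
proof -
  define P where "P = {y. \<forall>x\<in>R. orthogonal x y}"
  have "dim P + dim R = DIM('v)"
    using dim_subspace_orthogonal_to_vectors[OF R subspace_UNIV] by (simp add: P_def)
  moreover have sP: "subspace P"
    unfolding P_def orthogonal_def subspace_def by (auto simp: inner_add_right)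
  moreover have inj: "inj A"
    using A by (metis inner_zero_left less_irrefl linear_injective_0)
  then have "dim (A ` R) = dim R"
    using A(1) by (intro dim_image_eq) (auto simp: inj_on_def inj_def)
  moreover have sA: "subspace (A ` R)" using A(1) R linear_subspace_image by blast
  moreover have "A ` R \<inter> P = {0}"
  proof -
    have "A v = 0" if "v \<in> R" "A v \<in> P" for v
    proof -
      have "A v \<bullet> v = 0" using that by (auto simp: P_def orthogonal_def inner_commute)
      then show ?thesis using A(2)[of v] linear_0[OF A(1)] by (cases "v = 0") auto
    qed
    then show ?thesis using subspace_0[OF sA] subspace_0[OF sP] by auto
  qed
  ultimately have "dim {x + y |x y. x \<in> A ` R \<and> y \<in> P} = DIM('v)"
    using dim_sums_Int[OF sA sP] by simp
  moreover have "subspace {x + y |x y. x \<in> A ` R \<and> y \<in> P}"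
    by (rule subspace_sums[OF sA sP])
  ultimately have "{x + y |x y. x \<in> A ` R \<and> y \<in> P} = UNIV"
    by (simp only: dim_eq_full span_eq_iff[symmetric])
  then obtain v y where "v \<in> R" "y \<in> P" "b = A v + y" by blast
  then show ?thesis
    by (intro that[of v]) (auto simp: P_def orthogonal_def inner_diff_right inner_add_right)
qed

lemma min_norm_solution_orthogonal:
  fixes q z :: "'a::real_inner"
  assumes "\<And>t. norm q \<le> norm (q + t *\<^sub>R z)"
  shows "q \<bullet> z = 0"
proof (rule ccontr)
  assume nz: "q \<bullet> z \<noteq> 0"
  then have zz: "z \<bullet> z > 0" by auto
  \<comment> \<open>The minimiser of the quadratic polynomial \<open>norm (q + t z)\<close> squared
    in \<open>t\<close>.\<close>
  define t where "t = - (q \<bullet> z) / (z \<bullet> z)"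
  have "q \<bullet> q \<le> (q + t *\<^sub>R z) \<bullet> (q + t *\<^sub>R z)"
    using assms[of t] by (simp add: norm_le)
  also have "\<dots> = q \<bullet> q + 2 * t * (q \<bullet> z) + t * t * (z \<bullet> z)"
    by (simp add: inner_add_left inner_add_right inner_commute algebra_simps)
  also have "\<dots> = q \<bullet> q - (q \<bullet> z)\<^sup>2 / (z \<bullet> z)"
    using zz by (simp add: t_def field_simps power2_eq_square)
  finally have "(q \<bullet> z)\<^sup>2 / (z \<bullet> z) \<le> 0" by simp
  moreover have "(q \<bullet> z)\<^sup>2 / (z \<bullet> z) > 0" using nz zz by simp
  ultimately show False by simp
qed

text \<open>The Galerkin system is always solvable, so the least-squares solution of the normal
  equations is exact; the minimal norm shows up as orthogonality to the kernel of \<^term>\<open>W\<close>.\<close>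

lemma pinv_normal_equation:
  fixes W :: "'a::euclidean_space \<Rightarrow> 'v::euclidean_space" and b :: 'v
  assumes A: "linear A" "\<And>x. x \<noteq> 0 \<Longrightarrow> A x \<bullet> x > 0"
    and S: "subspace S" and W: "lin_on S W"
  defines "q \<equiv> pinv_on S (\<lambda>q. adjoint_on S W (A (W q))) (adjoint_on S W b)"
  shows "q \<in> S" "\<And>z. z \<in> S \<Longrightarrow> W z \<bullet> (A (W q) - b) = 0"
    "\<And>z. z \<in> S \<Longrightarrow> W z = 0 \<Longrightarrow> q \<bullet> z = 0"
proof -
  define Q where "Q = {q\<in>S. adjoint_on S W (A (W q)) = adjoint_on S W b}"
  have Q_iff: "x \<in> Q \<longleftrightarrow> x \<in> S \<and> (\<forall>z\<in>S. W z \<bullet> (A (W x) - b) = 0)" for x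
  proof -
    have "adjoint_on S W v = adjoint_on S W u \<longleftrightarrow> (\<forall>z\<in>S. W z \<bullet> (v - u) = 0)" for u v
    proof
      assume "adjoint_on S W v = adjoint_on S W u"
      then show "\<forall>z\<in>S. W z \<bullet> (v - u) = 0"
        using adjoint_on_works[OF S W] by (metis inner_diff_right right_minus_eq)
    next
      assume z: "\<forall>z\<in>S. W z \<bullet> (v - u) = 0"
      let ?d = "adjoint_on S W v - adjoint_on S W u"
      have "?d \<in> S" using adjoint_on_works(1)[OF S W] S subspace_diff by blast
      then have "?d \<bullet> ?d = 0"
        using z by (subst inner_diff_left) (simp add: adjoint_on_works(2)[OF S W] flip: inner_diff_right)
      then show "adjoint_on S W v = adjoint_on S W u" by simp
    qed
    then show ?thesis unfolding Q_def by blast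
  qed
  obtain v where "v \<in> W ` S" "\<And>u. u \<in> W ` S \<Longrightarrow> u \<bullet> (A v - b) = 0"
    using galerkin_solution_exists[OF A subspace_image_lin_on[OF S W]] by blast
  then obtain q0 where q0: "q0 \<in> Q" unfolding Q_iff by blast
  obtain g where g: "linear g" "\<And>x. x \<in> S \<Longrightarrow> g x = W x"
    using lin_on_extend[OF S W] by blast
  have Q_eq: "Q = S \<inter> (\<Inter>z\<in>S. {x. g z \<bullet> (A (g x) - b) = 0})"
    using g(2) unfolding set_eq_iff Q_iff by auto
  have "continuous_on UNIV (\<lambda>x. A (g x))"
    using linear_continuous_on[of "A \<circ> g" UNIV] linear_compose[OF g(1) A(1)]
    by (simp add: linear_conv_bounded_linear comp_def)
  then have "closed Q" unfolding Q_eq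
    by (intro closed_Int closed_subspace S closed_INT ballI closed_Collect_eq continuous_intros) auto
  have "convex {x. g z \<bullet> (A (g x) - b) = 0}" for z
  proof -
    have "linear (\<lambda>x. g z \<bullet> A (g x))"
      using g(1) A(1) by (intro linearI) (auto simp: linear_add linear_scale inner_add_right)
    then have "convex ((\<lambda>x. g z \<bullet> A (g x)) -` {g z \<bullet> b})"
      by (rule convex_linear_vimage) simp
    then show ?thesis by (simp add: vimage_def inner_diff_right)
  qed
  then have "convex Q" unfolding Q_eq by (intro convex_Int convex_INT) (use S subspace_imp_convex in auto)
  let ?T = "\<lambda>q. adjoint_on S W (A (W q))" and ?y = "adjoint_on S W b"
  \<comment> \<open>Since \<open>q0\<close> has residual 0, least-squares solutions are exact
    solutions, so the pseudoinverse picks the element of least norm in \<open>Q\<close>.\<close>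
  have ls: "(\<forall>w\<in>S. norm (?T x - ?y) \<le> norm (?T w - ?y)) \<longleftrightarrow> x \<in> Q" if "x \<in> S" for x
  proof
    assume "\<forall>w\<in>S. norm (?T x - ?y) \<le> norm (?T w - ?y)"
    then have "norm (?T x - ?y) \<le> norm (?T q0 - ?y)" using q0 Q_def by blast
    then show "x \<in> Q" using q0 that by (simp add: Q_def)
  qed (simp add: Q_def)
  have "q = (THE x. x \<in> Q \<and> (\<forall>z\<in>Q. norm x \<le> norm z))"
    unfolding q_def pinv_on_def using ls by (intro arg_cong[where f = The] ext) (auto simp: Q_def)
  \<comment> \<open>\<open>Q\<close> is closed, convex and nonempty, so the point closest to the
    origin exists and is unique; this makes the \<open>THE\<close> in the definition
    meaningful.\<close>
  moreover have "\<exists>!x. x \<in> Q \<and> (\<forall>z\<in>Q. norm x \<le> norm z)"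
  proof (rule ex1I)
    show "closest_point Q 0 \<in> Q \<and> (\<forall>z\<in>Q. norm (closest_point Q 0) \<le> norm z)"
      using closest_point_exists[OF \<open>closed Q\<close>, of 0] q0 by auto
    then show "x = closest_point Q 0" if "x \<in> Q \<and> (\<forall>z\<in>Q. norm x \<le> norm z)" for x
      using that by (intro any_closest_point_unique[OF \<open>convex Q\<close> \<open>closed Q\<close>, where a = 0]) auto
  qed
  ultimately have q: "q \<in> Q" "\<And>z. z \<in> Q \<Longrightarrow> norm q \<le> norm z"
    using theI'[of "\<lambda>x. x \<in> Q \<and> (\<forall>z\<in>Q. norm x \<le> norm z)"] by auto
  then show "q \<in> S" "\<And>z. z \<in> S \<Longrightarrow> W z \<bullet> (A (W q) - b) = 0" unfolding Q_iff by auto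
  fix z assume z: "z \<in> S" "W z = 0"
  have "q + t *\<^sub>R z \<in> Q" for t
  proof -
    have "W (q + t *\<^sub>R z) = W q"
      using z \<open>q \<in> S\<close> W S subspace_scale[OF S z(1)] unfolding lin_on_def by simp
    then show ?thesis using q(1) z S unfolding Q_iff by (simp add: subspace_add subspace_scale)
  qed
  then show "q \<bullet> z = 0" using q(2) by (intro min_norm_solution_orthogonal) auto
qed

text \<open>With constant rank, every kernel vector of the limit map is a limit of kernel vectors.\<close>

lemma kernel_orthogonal_limit:
  fixes W :: "nat \<Rightarrow> 'a::euclidean_space \<Rightarrow> 'v::euclidean_space"
  assumes S: "subspace S" and W: "\<And>n. lin_on S (W n)" and W': "lin_on S W'"
    and lim: "\<And>x. x \<in> S \<Longrightarrow> (\<lambda>n. W n x) \<longlonglongrightarrow> W' x"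
    and rank: "\<forall>\<^sub>F n in sequentially. dim (W n ` S) = dim (W' ` S)"
    and q: "q \<longlonglongrightarrow> q'" "\<And>n z. z \<in> S \<Longrightarrow> W n z = 0 \<Longrightarrow> q n \<bullet> z = 0"
    and z: "z \<in> S" "W' z = 0"
  shows "q' \<bullet> z = 0"
proof -
  obtain B where B: "finite B" "B \<subseteq> S" "\<And>i. i \<in> B \<Longrightarrow> norm i = 1"
    "\<And>(T :: 'a \<Rightarrow> 'v) q. lin_on S T \<Longrightarrow> q \<in> S \<Longrightarrow> T q = (\<Sum>i\<in>B. (q \<bullet> i) *\<^sub>R T i)"
    using lin_on_expand[OF S] by blast
  \<comment> \<open>A bound for the operator norm of \<open>W n - W'\<close> on \<open>S\<close>,
    built from finitely many basis vectors.\<close>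
  define e where "e n = (\<Sum>i\<in>B. norm (W n i - W' i))" for n
  have e: "e \<longlonglongrightarrow> 0" unfolding e_def
    by (intro tendsto_null_sum tendsto_norm_zero LIM_zero lim) (use B in auto)
  have unif: "norm (W n x - W' x) \<le> e n * norm x" if "x \<in> S" for n x
  proof -
    have "W n x - W' x = (\<Sum>i\<in>B. (x \<bullet> i) *\<^sub>R (W n i - W' i))"
      using B(4)[OF W that] B(4)[OF W' that] by (simp add: sum_subtractf scaleR_diff_right)
    also have "norm \<dots> \<le> (\<Sum>i\<in>B. norm x * norm (W n i - W' i))"
    proof (rule sum_norm_le)
      fix i assume "i \<in> B"
      then have "\<bar>x \<bullet> i\<bar> \<le> norm x" using Cauchy_Schwarz_ineq2[of x i] B(3) by simp
      then show "norm ((x \<bullet> i) *\<^sub>R (W n i - W' i)) \<le> norm x * norm (W n i - W' i)"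
        by (simp add: mult_right_mono)
    qed
    finally show ?thesis by (simp add: e_def sum_distrib_left mult.commute)
  qed
  obtain g where g: "linear g" "\<And>x. x \<in> S \<Longrightarrow> g x = W' x"
    using lin_on_extend[OF S W'] by blast
  define K where "K = {x\<in>S. W' x = 0}"
  \<comment> \<open>The orthogonal complement of the limit kernel within \<open>S\<close>.
    \<open>W'\<close> is injective on it and has the same image as on \<open>S\<close>, hence its
    dimension is the limit rank, and \<open>W'\<close> is bounded below there by some
    \<open>c\<close>.\<close>
  define C where "C = {y\<in>S. \<forall>x\<in>K. orthogonal x y}"
  have K: "subspace K"
  proof -
    have "K = S \<inter> {x. g x = 0}" using g K_def by auto
    then show ?thesis using S linear_subspace_kernel[OF g(1)] by (simp add: subspace_inter)
  qed
  have C: "subspace C" 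
    using S unfolding C_def orthogonal_def subspace_def by (auto simp: inner_add_right)
  have CS: "C \<subseteq> S" by (auto simp: C_def)
  have inj: "x = 0" if "x \<in> C" "W' x = 0" for x
    using that by (auto simp: C_def K_def orthogonal_def)
  have split: "\<exists>y\<in>C. \<exists>k\<in>K. x = y + k" if "x \<in> S" for x
  proof -
    obtain y k where yk: "y \<in> span K" "\<And>w. w \<in> span K \<Longrightarrow> orthogonal k w" "x = y + k"
      using orthogonal_subspace_decomp_exists by metis
    have spK: "span K = K" using K span_eq_iff by blast
    have y: "y \<in> K" using yk(1) unfolding spK .
    then have "k \<in> S" using that yk(3) S K_def
      by (metis (no_types, lifting) add_diff_cancel_left' mem_Collect_eq subspace_diff)
    then have "k \<in> C" using yk(2)[unfolded spK] by (auto simp: C_def orthogonal_commute)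
    then show ?thesis using y yk(3) by (metis add.commute)
  qed
  have "W' ` S = W' ` C"
  proof -
    have "W' x \<in> W' ` C" if x: "x \<in> S" for x
    proof -
      obtain y k where "y \<in> C" "k \<in> K" "x = y + k" using split[OF x] by blast
      then have "W' x = W' y" using W' CS unfolding lin_on_def K_def by auto
      then show ?thesis using \<open>y \<in> C\<close> by blast
    qed
    then show ?thesis using CS by blast
  qed
  moreover have dimC: "dim (T ` C) = dim C" if T: "lin_on S T" and 0: "\<And>x. x \<in> C \<Longrightarrow> T x = 0 \<Longrightarrow> x = 0"
    for T :: "'a \<Rightarrow> 'v"
  proof -
    obtain h where h: "linear h" "\<And>x. x \<in> S \<Longrightarrow> h x = T x"
      using lin_on_extend[OF S T] by blast
    have "T ` C = h ` C" using h(2) CS by (metis image_cong subsetD)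
    moreover have "inj_on h C"
      using h 0 CS C by (subst linear_injective_on_subspace_0) (auto simp: subset_iff)
    moreover have "span C = C" using C span_eq_iff by blast
    ultimately show ?thesis using dim_image_eq[OF h(1)] by metis
  qed
  ultimately have rk: "dim (W' ` S) = dim C" using dimC[OF W' inj] by simp
  obtain c where c: "c > 0" "\<And>x. x \<in> C \<Longrightarrow> c * norm x \<le> norm (W' x)"
  proof -
    have "\<exists>c>0. \<forall>x\<in>C. norm (g x) \<ge> c * norm x"
      using g inj CS C closed_subspace[OF C]
      by (intro injective_imp_isometric) (auto simp: linear_conv_bounded_linear subset_iff)
    then show ?thesis using that g(2) CS by (metis subsetD)
  qed
  have "\<forall>\<^sub>F n in sequentially. e n < c / 2"
    using e c(1) by (intro order_tendstoD(2)) auto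
  \<comment> \<open>The vector \<open>y\<close> corrects \<open>z\<close> to an element of the
    kernel of \<open>W n\<close>. The bound on \<open>y\<close> tends to 0 because
    \<open>W n z\<close> tends to \<open>W' z = 0\<close>.\<close>
  then have "\<forall>\<^sub>F n in sequentially. \<exists>y. W n (z - y) = 0 \<and> y \<in> S \<and> norm y \<le> 2 / c * norm (W n z)"
    using rank
  proof eventually_elim
    case (elim n)
    have lower: "c / 2 * norm x \<le> norm (W n x)" if "x \<in> C" for x
    proof -
      have "norm (W n x - W' x) \<le> c / 2 * norm x"
        using unif[of x n] that CS elim(1) by (smt (verit) mult_right_mono norm_ge_zero subsetD)
      then show ?thesis using c(2)[OF that] norm_triangle_ineq2[of "W' x" "W n x"]
        by (simp add: norm_minus_commute)
    qed
    have "x = 0" if "x \<in> C" "W n x = 0" for x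
      using lower[OF that(1)] that(2) c(1) by (simp add: mult_le_0_iff)
    \<comment> \<open>Here constant rank enters: the image of \<open>C\<close> under
      \<open>W n\<close> is a subspace of the image of \<open>S\<close> of the same dimension, so
      the two coincide and \<open>W n z\<close> has a preimage in \<open>C\<close>.\<close>
    then have "dim (W n ` C) = dim (W n ` S)" using dimC[OF W] rk elim(2) by simp
    moreover have "subspace (W n ` C)"
      using W[of n] C CS by (intro subspace_image_lin_on) (auto simp: lin_on_def subset_iff)
    ultimately have "W n ` C = W n ` S"
      using CS subspace_image_lin_on[OF S W] by (intro subspace_dim_equal) auto
    then obtain y where y: "y \<in> C" "W n z = W n y" using z(1) by (metis imageE imageI)
    then have "y \<in> S" "W n (z - y) = 0" using lin_on_diff[OF S W z(1), of y n] CS by auto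
    then show ?case using lower[OF y(1)] y(2) c(1)
      by (intro exI[of _ y]) (simp add: field_simps)
  qed
  then obtain y where y: "\<forall>\<^sub>F n in sequentially. W n (z - y n) = 0 \<and> y n \<in> S \<and> norm (y n) \<le> 2 / c * norm (W n z)"
    unfolding eventually_sequentially by metis
  have "(\<lambda>n. 2 / c * norm (W n z)) \<longlonglongrightarrow> 2 / c * norm (W' z)"
    by (intro tendsto_intros lim z)
  then have "(\<lambda>n. 2 / c * norm (W n z)) \<longlonglongrightarrow> 0" using z(2) by simp
  moreover have "\<forall>\<^sub>F n in sequentially. norm (y n) \<le> 2 / c * norm (W n z)"
    using y by eventually_elim simp
  ultimately have "y \<longlonglongrightarrow> 0" by (rule Lim_null_comparison[rotated])
  then have "(\<lambda>n. q n \<bullet> (z - y n)) \<longlonglongrightarrow> q' \<bullet> (z - 0)"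
    by (intro tendsto_intros q)
  moreover have "\<forall>\<^sub>F n in sequentially. q n \<bullet> (z - y n) = 0"
    using y by eventually_elim (use q z S subspace_diff in blast)
  then have "(\<lambda>n. q n \<bullet> (z - y n)) \<longlonglongrightarrow> 0" by (rule tendsto_eventually)
  ultimately show ?thesis using LIMSEQ_unique by fastforce
qed

subsection \<open>Multilinear maps\<close>

text \<open>Functions carry the product topology, so parameters converge exactly when all
  coordinates do.\<close>

lemma tendsto_fun_iff:
  fixes f :: "'a \<Rightarrow> 'i \<Rightarrow> 'b::topological_space"
  shows "(f \<longlongrightarrow> l) F \<longleftrightarrow> (\<forall>i. ((\<lambda>x. f x i) \<longlongrightarrow> l i) F)"
proof -
  have "(f \<longlongrightarrow> l) F \<longleftrightarrow> limitin (product_topology (\<lambda>i. euclidean) UNIV) f l F"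
    by (simp add: euclidean_product_topology)
  then show ?thesis by (simp add: limitin_componentwise)
qed

locale multilinear_format =
  fixes L :: nat and S :: "nat \<Rightarrow> 'p::euclidean_space set" and U :: "(nat \<Rightarrow> 'p) \<Rightarrow> 'v::euclidean_space"
  assumes subspace_S: "\<mu> \<in> {1..L} \<Longrightarrow> subspace (S \<mu>)"
    and lin: "p \<in> param_space L S \<Longrightarrow> \<mu> \<in> {1..L} \<Longrightarrow> lin_on (S \<mu>) (Wmap U \<mu> p)"
begin

abbreviation "P \<equiv> param_space L S"

lemma param_upd: "p \<in> P \<Longrightarrow> \<mu> \<in> {1..L} \<Longrightarrow> q \<in> S \<mu> \<Longrightarrow> p(\<mu> := q) \<in> P"
  by (auto simp: param_space_def)

lemma param_in: "p \<in> P \<Longrightarrow> \<mu> \<in> {1..L} \<Longrightarrow> p \<mu> \<in> S \<mu>"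
  by (auto simp: param_space_def)

lemma param_out: "p \<in> P \<Longrightarrow> \<mu> \<notin> {1..L} \<Longrightarrow> p \<mu> = 0"
  by (auto simp: param_space_def)

lemma param_line: "p \<in> P \<Longrightarrow> h \<in> P \<Longrightarrow> (\<lambda>\<nu>. p \<nu> + t *\<^sub>R h \<nu>) \<in> P"
  using subspace_S by (auto simp: param_space_def subspace_add subspace_scale)

lemma closed_param: "closed P"
proof -
  have "P = (\<Inter>\<mu>\<in>{1..L}. {p. p \<mu> \<in> S \<mu>}) \<inter> (\<Inter>\<mu>\<in>-{1..L}. {p. p \<mu> = 0})"
    by (auto simp: param_space_def)
  moreover have "closed {p. p \<mu> \<in> S \<mu>}" if "\<mu> \<in> {1..L}" for \<mu>
    using closed_vimage[OF closed_subspace[OF subspace_S[OF that]] continuous_on_product_coordinates[of \<mu>]]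
    by (simp add: vimage_def)
  moreover have "closed {p :: nat \<Rightarrow> 'p. p \<mu> = 0}" for \<mu>
    by (intro closed_Collect_eq continuous_on_product_coordinates continuous_intros)
  ultimately show ?thesis by (auto intro!: closed_Int closed_INT)
qed

text \<open>Continuity of a multilinear map, by induction on the number of slots that may vary.
  Expanding slot \<open>Suc j\<close> in a basis leaves finitely many terms in which that slot is
  frozen at a basis vector.\<close>

lemma U_tendsto_aux:
  fixes p :: "nat \<Rightarrow> nat \<Rightarrow> 'p"
  assumes "j \<le> L" "\<And>n. p n \<in> P" "c \<in> P" "p \<longlonglongrightarrow> c" "\<And>n \<nu>. \<nu> > j \<Longrightarrow> p n \<nu> = c \<nu>"
  shows "(\<lambda>n. U (p n)) \<longlonglongrightarrow> U c"
  using assms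
proof (induction j arbitrary: p c)
  case 0
  have "p n = c" for n
  proof
    \<comment> \<open>Index 0 lies outside \<open>{1..L}\<close>, so both parameters vanish
      there.\<close>
    fix \<nu> show "p n \<nu> = c \<nu>"
      using 0(5)[of \<nu> n] param_out[OF 0(2)[of n], of \<nu>] param_out[OF 0(3), of \<nu>] by (cases "\<nu> = 0") auto
  qed
  then show ?case by simp
next
  case (Suc j)
  let ?\<mu> = "Suc j"
  have \<mu>: "?\<mu> \<in> {1..L}" using Suc.prems(1) by auto
  obtain B where B: "finite B" "B \<subseteq> S ?\<mu>" "\<And>i. i \<in> B \<Longrightarrow> norm i = 1"
    "\<And>(T :: 'p \<Rightarrow> 'v) q. lin_on (S ?\<mu>) T \<Longrightarrow> q \<in> S ?\<mu> \<Longrightarrow> T q = (\<Sum>i\<in>B. (q \<bullet> i) *\<^sub>R T i)"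
    using lin_on_expand[OF subspace_S[OF \<mu>]] by blast
  have U: "U d = (\<Sum>i\<in>B. (d ?\<mu> \<bullet> i) *\<^sub>R U (d(?\<mu> := i)))" if "d \<in> P" for d
    using B(4)[OF lin[OF that \<mu>] param_in[OF that \<mu>]] by (simp add: Wmap_def)
  have "(\<lambda>n. \<Sum>i\<in>B. (p n ?\<mu> \<bullet> i) *\<^sub>R U ((p n)(?\<mu> := i)))
      \<longlonglongrightarrow> (\<Sum>i\<in>B. (c ?\<mu> \<bullet> i) *\<^sub>R U (c(?\<mu> := i)))"
  proof (intro tendsto_sum tendsto_scaleR tendsto_inner tendsto_const)
    show "(\<lambda>n. p n ?\<mu>) \<longlonglongrightarrow> c ?\<mu>" using Suc.prems(4)[unfolded tendsto_fun_iff] by blast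
    fix i assume "i \<in> B"
    then have "i \<in> S ?\<mu>" using B by blast
    then show "(\<lambda>n. U ((p n)(?\<mu> := i))) \<longlonglongrightarrow> U (c(?\<mu> := i))"
      using Suc.prems \<mu> by (intro Suc.IH param_upd) (auto simp: tendsto_fun_iff)
  qed
  then show ?case using U[OF Suc.prems(2)] U[OF Suc.prems(3)] by simp
qed

lemma U_tendsto:
  fixes p :: "nat \<Rightarrow> nat \<Rightarrow> 'p"
  assumes "\<And>n. p n \<in> P" "c \<in> P" "p \<longlonglongrightarrow> c"
  shows "(\<lambda>n. U (p n)) \<longlonglongrightarrow> U c"
  using assms param_out[OF assms(1)] param_out[OF assms(2)] by (intro U_tendsto_aux[of L]) auto

section \<open>Derivatives along lines and criticality\<close>

text \<open>The product rule, by induction on the number of slots in which the direction may be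
  nonzero.\<close>

lemma U_line_derivative_aux:
  assumes "j \<le> L" "p \<in> P" "h \<in> P" "\<And>\<nu>. \<nu> > j \<Longrightarrow> h \<nu> = 0"
  shows "((\<lambda>t. U (\<lambda>\<nu>. p \<nu> + t *\<^sub>R h \<nu>)) has_vector_derivative (\<Sum>\<mu>=1..j. U (p(\<mu> := h \<mu>)))) (at 0)"
  using assms
proof (induction j arbitrary: p h)
  case 0
  have "h \<nu> = 0" for \<nu>
    using 0(4)[of \<nu>] param_out[OF 0(3), of \<nu>] by (cases "\<nu> = 0") auto
  then show ?case by simp
next
  case (Suc j)
  let ?\<mu> = "Suc j"
  have \<mu>: "?\<mu> \<in> {1..L}" using Suc.prems(1) by auto
  \<comment> \<open>Linearity in slot \<open>Suc j\<close> splits off the term \<open>t\<close>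
    times \<open>U\<close> on the line through \<open>p'\<close>; both remaining lines have
    direction \<open>h'\<close>, which no longer moves this slot.\<close>
  define h' where "h' = h(?\<mu> := 0)"
  define p' where "p' = p(?\<mu> := h ?\<mu>)"
  have h': "h' \<in> P" unfolding h'_def using Suc.prems \<mu> subspace_0[OF subspace_S[OF \<mu>]] by (intro param_upd)
  have p': "p' \<in> P" unfolding p'_def using Suc.prems \<mu> by (intro param_upd param_in)
  have h'0: "h' \<nu> = 0" if "\<nu> > j" for \<nu>
    using that Suc.prems(4)[of \<nu>] by (cases "\<nu> = ?\<mu>") (auto simp: h'_def)
  have jL: "j \<le> L" using Suc.prems(1) by simp
  have "U (\<lambda>\<nu>. p \<nu> + t *\<^sub>R h \<nu>) = U (\<lambda>\<nu>. p \<nu> + t *\<^sub>R h' \<nu>) + t *\<^sub>R U (\<lambda>\<nu>. p' \<nu> + t *\<^sub>R h' \<nu>)" for t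
  proof -
    let ?r = "\<lambda>\<nu>. p \<nu> + t *\<^sub>R h \<nu>"
    have S: "h ?\<mu> \<in> S ?\<mu>" "p ?\<mu> \<in> S ?\<mu>" using Suc.prems \<mu> param_in by auto
    have *: "Wmap U ?\<mu> ?r (p ?\<mu> + t *\<^sub>R h ?\<mu>) = Wmap U ?\<mu> ?r (p ?\<mu>) + t *\<^sub>R Wmap U ?\<mu> ?r (h ?\<mu>)"
      using lin[OF param_line[OF Suc.prems(2,3), of t] \<mu>] S subspace_scale[OF subspace_S[OF \<mu>] S(1), of t]
      unfolding lin_on_def by simp
    have "?r(?\<mu> := p ?\<mu> + t *\<^sub>R h ?\<mu>) = ?r" "?r(?\<mu> := p ?\<mu>) = (\<lambda>\<nu>. p \<nu> + t *\<^sub>R h' \<nu>)"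
      "?r(?\<mu> := h ?\<mu>) = (\<lambda>\<nu>. p' \<nu> + t *\<^sub>R h' \<nu>)"
      by (auto simp: h'_def p'_def fun_eq_iff)
    then show ?thesis using * unfolding Wmap_def by simp
  qed
  \<comment> \<open>The factor \<open>t\<close> vanishes at 0, so the derivative of its cofactor is
    multiplied by 0 and only the value at \<open>p'\<close> survives.\<close>
  moreover have "((\<lambda>t. U (\<lambda>\<nu>. p \<nu> + t *\<^sub>R h' \<nu>) + t *\<^sub>R U (\<lambda>\<nu>. p' \<nu> + t *\<^sub>R h' \<nu>)) has_vector_derivative
      (\<Sum>\<mu>=1..j. U (p(\<mu> := h' \<mu>))) + (0 *\<^sub>R (\<Sum>\<mu>=1..j. U (p'(\<mu> := h' \<mu>))) + 1 *\<^sub>R U (\<lambda>\<nu>. p' \<nu> + 0 *\<^sub>R h' \<nu>))) (at 0)"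
    by (intro has_vector_derivative_add has_vector_derivative_scaleR Suc.IH Suc.prems h' p' h'0 jL DERIV_ident)
  moreover have "(\<Sum>\<mu>=1..j. U (p(\<mu> := h' \<mu>))) = (\<Sum>\<mu>=1..j. U (p(\<mu> := h \<mu>)))"
    by (rule sum.cong) (auto simp: h'_def)
  then have "(\<Sum>\<mu>=1..j. U (p(\<mu> := h' \<mu>))) + (0 *\<^sub>R (\<Sum>\<mu>=1..j. U (p'(\<mu> := h' \<mu>))) + 1 *\<^sub>R U (\<lambda>\<nu>. p' \<nu> + 0 *\<^sub>R h' \<nu>))
      = (\<Sum>\<mu>=1..Suc j. U (p(\<mu> := h \<mu>)))"
    unfolding p'_def[symmetric] by (simp add: p'_def[symmetric])
  ultimately show ?case by (simp only:)
qed

text \<open>The derivative of \<open>U\<close> along \<open>h\<close> is a sum of vectors in the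
  ranges of the maps \<open>Wmap U \<mu> c\<close>, each orthogonal to the residual. Symmetry of
  \<open>A\<close> turns the derivative of the energy into a multiple of the inner product of that
  sum with the residual.\<close>

lemma is_crit_normal_equations:
  fixes b :: 'v
  assumes A: "linear A" "\<And>x y. A x \<bullet> y = x \<bullet> A y" and c: "c \<in> P"
    and normal: "\<And>\<mu> z. \<mu> \<in> {1..L} \<Longrightarrow> z \<in> S \<mu> \<Longrightarrow> Wmap U \<mu> c z \<bullet> (A (U c) - b) = 0"
  shows "is_crit L S U A b c"
  unfolding is_crit_def
proof
  fix h assume h: "h \<in> P"
  define u where "u t = U (\<lambda>\<nu>. c \<nu> + t *\<^sub>R h \<nu>)" for t
  define D where "D = (\<Sum>\<mu>=1..L. U (c(\<mu> := h \<mu>)))"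
  have u: "(u has_vector_derivative D) (at 0)"
    unfolding u_def D_def using U_line_derivative_aux[OF order_refl c h] param_out[OF h] by auto
  have "bounded_linear A" using A(1) by (simp add: linear_conv_bounded_linear)
  then have Au: "((\<lambda>t. A (u t)) has_vector_derivative A D) (at 0)"
    using u by (rule bounded_linear.has_vector_derivative)
  have "D \<bullet> (A (u 0) - b) = 0"
    using normal param_in[OF h] by (auto simp: D_def u_def inner_sum_left Wmap_def intro!: sum.neutral)
  moreover have "((\<lambda>t. ffun A b (u t)) has_real_derivative
      (1 / (norm b)\<^sup>2) * ((1/2) * (A (u 0) \<bullet> D + A D \<bullet> u 0) - b \<bullet> D)) (at 0)"
    unfolding ffun_def has_real_derivative_iff_has_vector_derivative has_vector_derivative_def
    by (rule derivative_eq_intros u[unfolded has_vector_derivative_def] Au[unfolded has_vector_derivative_def] refl)+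
       (auto simp: algebra_simps)
  moreover have "A D \<bullet> u 0 = D \<bullet> A (u 0)" by (rule A(2))
  ultimately show "((\<lambda>t. ffun A b (U (\<lambda>\<nu>. c \<nu> + t *\<^sub>R h \<nu>))) has_real_derivative 0) (at 0)"
    by (simp add: u_def inner_diff_right inner_commute)
qed

end

subsection \<open>Alternating least squares\<close>

lemma frequently_close_imp_subseq:
  fixes f :: "nat \<Rightarrow> 'm::metric_space"
  assumes "\<And>e. e > 0 \<Longrightarrow> \<exists>\<^sub>F n in sequentially. dist (f n) c < e"
  obtains r where "strict_mono r" "(\<lambda>n. f (r n)) \<longlonglongrightarrow> c"
proof -
  have "\<exists>r. \<forall>n. dist (f (r n)) c < inverse (real (Suc n)) \<and> r n < r (Suc n)"
  proof (rule dependent_nat_choice)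
    have *: "\<exists>n\<ge>N. dist (f n) c < inverse (real (Suc k))" for N k
      using assms[of "inverse (real (Suc k))"] by (simp add: frequently_sequentially)
    show "\<exists>n. dist (f n) c < inverse (real (Suc 0))" using * by blast
    show "\<exists>n'. dist (f n') c < inverse (real (Suc (Suc k))) \<and> n < n'" for n k
      using *[of "Suc n" "Suc k"] Suc_le_lessD by blast
  qed
  then obtain r where r: "\<And>n. dist (f (r n)) c < inverse (real (Suc n))" "\<And>n. r n < r (Suc n)" by blast
  have "(\<lambda>n. dist (f (r n)) c) \<longlonglongrightarrow> 0"
    using r(1) by (intro Lim_null_comparison[OF _ LIMSEQ_inverse_real_of_nat])
      (auto intro!: always_eventually less_imp_le)
  then show ?thesis using that r(2) by (metis tendsto_dist_iff strict_mono_Suc_iff)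
qed

text \<open>Describes subsequential limits by an intersection of closed sets, which makes closedness
  of the set of accumulation points immediate.\<close>

lemma subseq_limit_iff_closure:
  fixes f :: "nat \<Rightarrow> 'm::metric_space"
  shows "(\<exists>r. strict_mono r \<and> (\<lambda>n. f (r n)) \<longlonglongrightarrow> c) \<longleftrightarrow> (\<forall>N. c \<in> closure (f ` {N..}))"
proof
  assume "\<exists>r. strict_mono r \<and> (\<lambda>n. f (r n)) \<longlonglongrightarrow> c"
  then obtain r where r: "strict_mono r" "(\<lambda>n. f (r n)) \<longlonglongrightarrow> c" by blast
  show "\<forall>N. c \<in> closure (f ` {N..})"
  proof
    fix N
    have "r (n + N) \<ge> N" for n
      using seq_suble[OF r(1), of "n + N"] by simp
    then have "f (r (n + N)) \<in> f ` {N..}" for n by simp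
    moreover have "(\<lambda>n. f (r (n + N))) \<longlonglongrightarrow> c" using r(2) by (rule LIMSEQ_ignore_initial_segment)
    ultimately show "c \<in> closure (f ` {N..})" unfolding closure_sequential
      by (intro exI[of _ "\<lambda>n. f (r (n + N))"]) blast
  qed
next
  assume cl: "\<forall>N. c \<in> closure (f ` {N..})"
  have "\<exists>\<^sub>F n in sequentially. dist (f n) c < e" if "e > 0" for e
    using cl that unfolding frequently_sequentially closure_approachable by force
  then show "\<exists>r. strict_mono r \<and> (\<lambda>n. f (r n)) \<longlonglongrightarrow> c"
    using frequently_close_imp_subseq[of f c] by blast
qed

lemma norm_le_pnorm: "\<mu> \<in> {1..L} \<Longrightarrow> norm (p \<mu>) \<le> pnorm L p"
  unfolding pnorm_def by (intro real_le_rsqrt member_le_sum) auto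

lemma continuous_on_pnorm: "continuous_on A (pnorm L :: (nat \<Rightarrow> 'p::real_normed_vector) \<Rightarrow> real)"
proof -
  have "continuous_on UNIV (pnorm L :: (nat \<Rightarrow> 'p) \<Rightarrow> real)"
    unfolding pnorm_def by (intro continuous_intros continuous_on_product_coordinates)
  then show ?thesis by (rule continuous_on_subset) simp
qed

text \<open>Links the norm used for accumulation points in the rank assumption with the product
  topology. \<open>pnorm L\<close> sees only the slots in \<open>{1..L}\<close>, hence the vanishing
  conditions elsewhere.\<close>

lemma pnorm_tendsto_0_iff:
  fixes f :: "nat \<Rightarrow> nat \<Rightarrow> 'p::real_normed_vector"
  assumes "\<And>n \<nu>. \<nu> \<notin> {1..L} \<Longrightarrow> f n \<nu> = 0" "\<And>\<nu>. \<nu> \<notin> {1..L} \<Longrightarrow> c \<nu> = 0"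
  shows "(\<lambda>n. pnorm L (\<lambda>\<nu>. f n \<nu> - c \<nu>)) \<longlonglongrightarrow> 0 \<longleftrightarrow> f \<longlonglongrightarrow> c"
proof
  assume lim: "(\<lambda>n. pnorm L (\<lambda>\<nu>. f n \<nu> - c \<nu>)) \<longlonglongrightarrow> 0"
  have "(\<lambda>n. f n \<nu>) \<longlonglongrightarrow> c \<nu>" for \<nu>
  proof (cases "\<nu> \<in> {1..L}")
    case True
    have "(\<lambda>n. f n \<nu> - c \<nu>) \<longlonglongrightarrow> 0"
      using norm_le_pnorm[OF True, of "\<lambda>\<nu>. f _ \<nu> - c \<nu>"]
      by (intro Lim_null_comparison[OF _ lim] always_eventually) auto
    then show ?thesis by (rule LIM_zero_cancel)
  next
    case False
    then show ?thesis using assms by simp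
  qed
  then show "f \<longlonglongrightarrow> c" by (simp add: tendsto_fun_iff)
next
  assume "f \<longlonglongrightarrow> c"
  then have "(\<lambda>n. f n \<nu>) \<longlonglongrightarrow> c \<nu>" for \<nu> by (simp add: tendsto_fun_iff)
  then have "(\<lambda>n. pnorm L (\<lambda>\<nu>. f n \<nu> - c \<nu>)) \<longlonglongrightarrow> pnorm L (\<lambda>\<nu>. c \<nu> - c \<nu>)"
    unfolding pnorm_def by (intro tendsto_intros)
  then show "(\<lambda>n. pnorm L (\<lambda>\<nu>. f n \<nu> - c \<nu>)) \<longlonglongrightarrow> 0" by (simp add: pnorm_def)
qed

text \<open>The constant is the minimum of the quadratic form on the compact unit sphere; scaling
  gives the bound for every vector.\<close>

lemma positive_definite_coercive:
  fixes A :: "'v::euclidean_space \<Rightarrow> 'v"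
  assumes "linear A" "\<And>x. x \<noteq> 0 \<Longrightarrow> A x \<bullet> x > 0"
  obtains c where "c > 0" "\<And>x. A x \<bullet> x \<ge> c * (norm x)\<^sup>2"
proof -
  have cont: "continuous_on (sphere 0 1) (\<lambda>x. A x \<bullet> x)"
    using assms(1) by (intro continuous_intros linear_continuous_on) (simp add: linear_conv_bounded_linear)
  obtain y where y: "y \<in> sphere 0 1" "\<And>x. x \<in> sphere 0 1 \<Longrightarrow> A y \<bullet> y \<le> A x \<bullet> x"
    using continuous_attains_inf[OF compact_sphere _ cont] by auto
  show ?thesis
  proof (rule that)
    show "A y \<bullet> y > 0" using y(1) by (intro assms(2)) auto
    fix x :: 'v
    show "A x \<bullet> x \<ge> (A y \<bullet> y) * (norm x)\<^sup>2"
    proof (cases "x = 0")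
      case False
      have "A y \<bullet> y \<le> A (x /\<^sub>R norm x) \<bullet> (x /\<^sub>R norm x)" using False by (intro y(2)) simp
      also have "\<dots> = (A x \<bullet> x) / (norm x)\<^sup>2"
        by (simp add: linear_scale[OF assms(1)] power2_eq_square divide_inverse)
      finally show ?thesis using False by (simp add: field_simps)
    qed (simp add: linear_0[OF assms(1)])
  qed
qed

section \<open>The sequence of micro-steps and its energy\<close>

locale als_sequence = multilinear_format L S U
  for L :: nat and S :: "nat \<Rightarrow> 'p::euclidean_space set" and U :: "(nat \<Rightarrow> 'p) \<Rightarrow> 'v::euclidean_space" +
  fixes A :: "'v \<Rightarrow> 'v" and b :: 'v and pk :: "nat \<Rightarrow> nat \<Rightarrow> 'p"
  assumes L: "L \<ge> 1"
    and A: "linear A" and A_sym: "A v \<bullet> w = v \<bullet> A w" and A_pos: "v \<noteq> 0 \<Longrightarrow> A v \<bullet> v > 0"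
    and ALS: "is_ALS_seq L S U A b pk" and A2: "assumption_A2 L S U pk"
begin

text \<open>All micro-steps in one sequence: \<open>x (L * (k - 1) + \<mu>)\<close> is the paper's \<open>\<^bold>p\<^bsub>k,\<mu>\<^esub>\<close> for \<open>0 \<le> \<mu> < L\<close>.\<close>

definition x :: "nat \<Rightarrow> nat \<Rightarrow> 'p" where
  "x n = als_mix pk (Suc (n div L)) (n mod L)"

lemma idx_in: "Suc (n mod L) \<in> {1..L}"
  using L by (simp add: Suc_leI)

lemma pk_P: "k \<ge> 1 \<Longrightarrow> pk k \<in> P"
  using ALS by (simp add: is_ALS_seq_def)

lemma als_mix_P: "k \<ge> 1 \<Longrightarrow> als_mix pk k \<mu> \<in> P"
  using pk_P[of k] pk_P[of "Suc k"] by (auto simp: als_mix_def param_space_def)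

lemma x_P: "x n \<in> P"
  unfolding x_def by (rule als_mix_P) simp

lemma x_mult_add: "\<mu> < L \<Longrightarrow> x (k * L + \<mu>) = als_mix pk (Suc k) \<mu>"
  by (simp add: x_def)

lemma x_Suc: "x (Suc n) = (x n)(Suc (n mod L) := pk (Suc (Suc (n div L))) (Suc (n mod L)))"
proof (cases "Suc (n mod L) = L")
  \<comment> \<open>The last slot has just been updated: the sweep ends, and the parameter with all
    slots new is the one with no new slot in the next sweep.\<close>
  case True
  then have "x (Suc n) = als_mix pk (Suc (Suc (n div L))) 0" by (simp add: x_def mod_Suc div_Suc)
  then show ?thesis
    using True param_out[OF pk_P[of "Suc (n div L)"]] param_out[OF pk_P[of "Suc (Suc (n div L))"]]
    by (auto simp: x_def als_mix_def fun_eq_iff)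
next
  case False
  then show ?thesis by (auto simp: x_def mod_Suc div_Suc als_mix_def fun_eq_iff)
qed

lemma x_step:
  fixes n
  defines "\<mu> \<equiv> Suc (n mod L)"
  shows "x (Suc n) \<mu> \<in> S \<mu>"
    and "Wmap U \<mu> (x n) (x (Suc n) \<mu>) = U (x (Suc n))"
    and "z \<in> S \<mu> \<Longrightarrow> Wmap U \<mu> (x n) z \<bullet> (A (U (x (Suc n))) - b) = 0"
    and "z \<in> S \<mu> \<Longrightarrow> Wmap U \<mu> (x n) z = 0 \<Longrightarrow> x (Suc n) \<mu> \<bullet> z = 0"
proof -
  have \<mu>: "\<mu> \<in> {1..L}" unfolding \<mu>_def by (rule idx_in)
  have W: "als_W U pk (Suc (n div L)) \<mu> = Wmap U \<mu> (x n)"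
    by (simp add: als_W_def x_def \<mu>_def)
  have "x (Suc n) \<mu> = pk (Suc (Suc (n div L))) \<mu>" by (simp add: x_Suc \<mu>_def)
  also have "\<dots> = pinv_on (S \<mu>) (\<lambda>q. adjoint_on (S \<mu>) (Wmap U \<mu> (x n)) (A (Wmap U \<mu> (x n) q)))
      (adjoint_on (S \<mu>) (Wmap U \<mu> (x n)) b)"
    using ALS \<mu> unfolding is_ALS_seq_def als_G_def W[symmetric] by simp
  finally have q: "x (Suc n) \<mu> = \<dots>" .
  note sol = pinv_normal_equation[OF A A_pos subspace_S[OF \<mu>] lin[OF x_P[of n] \<mu>], where b = b, folded q]
  show U: "Wmap U \<mu> (x n) (x (Suc n) \<mu>) = U (x (Suc n))"
    by (simp add: Wmap_def x_Suc \<mu>_def)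
  show "x (Suc n) \<mu> \<in> S \<mu>" using sol(1) by auto
  show "Wmap U \<mu> (x n) z \<bullet> (A (U (x (Suc n))) - b) = 0" if "z \<in> S \<mu>"
    using sol(2)[of z] that U by simp
  show "x (Suc n) \<mu> \<bullet> z = 0" if "z \<in> S \<mu>" "Wmap U \<mu> (x n) z = 0"
    using sol(3)[of z] that by simp
qed

lemma x_bounded: obtains C where "\<And>n \<nu>. norm (x n \<nu>) \<le> C"
proof -
  obtain C where C: "\<And>k. k \<ge> 1 \<Longrightarrow> pnorm L (pk k) \<le> C"
    using A2 unfolding assumption_A2_def by blast
  have pk: "norm (pk k \<nu>) \<le> max C 0" if "k \<ge> 1" for k \<nu>
    using C[OF that] norm_le_pnorm[of \<nu> L "pk k"] param_out[OF pk_P[OF that], of \<nu>]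
    by (cases "\<nu> \<in> {1..L}") auto
  have "norm (x n \<nu>) \<le> max C 0" for n \<nu>
    using pk[of "Suc (n div L)" \<nu>] pk[of "Suc (Suc (n div L))" \<nu>] by (auto simp: x_def als_mix_def)
  then show ?thesis using that by blast
qed

text \<open>A product of closed balls is compact by Tychonoff's theorem, and \<open>P\<close> is
  closed in the product topology.\<close>

lemma x_compact: obtains K where "compact K" "K \<subseteq> P" "\<And>n. x n \<in> K"
proof -
  obtain C where C: "\<And>n \<nu>. norm (x n \<nu>) \<le> C" using x_bounded by blast
  have "compactin (product_topology (\<lambda>i. euclidean) UNIV) (PiE UNIV (\<lambda>_::nat. cball (0::'p) C))"
    unfolding compactin_PiE by simp
  then have "compact (PiE UNIV (\<lambda>_::nat. cball (0::'p) C))"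
    by (simp add: euclidean_product_topology)
  then have "compact (P \<inter> PiE UNIV (\<lambda>_::nat. cball (0::'p) C))"
    using closed_param by (rule closed_Int_compact[rotated])
  then show ?thesis using C x_P that by (auto simp: PiE_def)
qed

lemma x_subseq_limit:
  fixes f :: "nat \<Rightarrow> nat"
  obtains c s where "strict_mono s" "(\<lambda>n. x (f (s n))) \<longlonglongrightarrow> c" "c \<in> P"
proof -
  obtain K where K: "compact K" "K \<subseteq> P" "\<And>n. x n \<in> K" using x_compact by blast
  obtain c s where "c \<in> K" "strict_mono s" "((\<lambda>n. x (f n)) \<circ> s) \<longlonglongrightarrow> c"
    using seq_compactE[OF compact_imp_seq_compact[OF K(1)], of "\<lambda>n. x (f n)"] K(3) by blast
  then show ?thesis using K(2) by (intro that[of s c]) (auto simp: comp_def)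
qed

lemma U_x_tendsto: "c \<in> P \<Longrightarrow> (\<lambda>n. x (f n)) \<longlonglongrightarrow> c \<Longrightarrow> (\<lambda>n. U (x (f n))) \<longlonglongrightarrow> U c"
  using x_P by (intro U_tendsto) auto

text \<open>By \<open>A\<close>-orthogonality each micro-step lowers the energy by half the squared \<open>A\<close>-norm of
  the increment, and the energy is bounded below.\<close>

lemma U_x_diff: "(\<lambda>n. U (x (Suc n)) - U (x n)) \<longlonglongrightarrow> 0"
proof -
  define v where "v n = U (x n)" for n
  define g where "g w = (1/2) * (A w \<bullet> w) - b \<bullet> w" for w
  obtain c where c: "c > 0" "\<And>w. A w \<bullet> w \<ge> c * (norm w)\<^sup>2"
    using positive_definite_coercive[OF A A_pos] by blast
  have desc: "g (v n) - g (v (Suc n)) \<ge> c / 2 * (norm (v (Suc n) - v n))\<^sup>2" for n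
  proof -
    let ?\<mu> = "Suc (n mod L)" and ?d = "v (Suc n) - v n"
    \<comment> \<open>The old tensor also lies in the range of the current map, so the increment
      \<open>?d\<close> is an admissible test vector in the normal equations.\<close>
    have vn: "v n = Wmap U ?\<mu> (x n) (x n ?\<mu>)" by (simp add: v_def Wmap_def)
    have "x n ?\<mu> \<in> S ?\<mu>" by (rule param_in[OF x_P idx_in])
    then have "?d = Wmap U ?\<mu> (x n) (x (Suc n) ?\<mu> - x n ?\<mu>)" "x (Suc n) ?\<mu> - x n ?\<mu> \<in> S ?\<mu>"
      using lin_on_diff[OF subspace_S lin[OF x_P], OF idx_in idx_in x_step(1)]
        subspace_diff[OF subspace_S[OF idx_in] x_step(1)] x_step(2) vn by (auto simp: v_def)
    then have "?d \<bullet> (A (v (Suc n)) - b) = 0" using x_step(3)[of _ n] by (simp add: v_def)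
    then have "g (v n) - g (v (Suc n)) = (1/2) * (A ?d \<bullet> ?d)"
      using A_sym[of "v n" "v (Suc n)"] A_sym[of "v (Suc n)" "v n"]
      by (simp add: g_def linear_diff[OF A] inner_diff_left inner_diff_right inner_commute algebra_simps)
    then show ?thesis using c(2)[of ?d] by simp
  qed
  \<comment> \<open>Completing the square in \<open>norm w\<close> after coercivity and
    Cauchy-Schwarz.\<close>
  have "g w \<ge> - (norm b)\<^sup>2 / (2 * c)" for w
  proof -
    have "0 \<le> (c * norm w - norm b)\<^sup>2 / (2 * c)" using c(1) by simp
    also have "\<dots> = c / 2 * (norm w)\<^sup>2 - norm b * norm w + (norm b)\<^sup>2 / (2 * c)"
      using c(1) by (simp add: power2_eq_square field_simps)
    finally show ?thesis using c(2)[of w] norm_cauchy_schwarz[of b w] by (simp add: g_def)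
  qed
  moreover have "g (v (Suc n)) \<le> g (v n)" for n
    using desc[of n] c(1) by (smt (verit) divide_nonneg_pos mult_nonneg_nonneg zero_le_power2)
  then have "decseq (\<lambda>n. g (v n))" by (simp add: decseq_Suc_iff)
  ultimately obtain l where "(\<lambda>n. g (v n)) \<longlonglongrightarrow> l"
    using decseq_convergent[of "\<lambda>n. g (v n)"] by metis
  then have "(\<lambda>n. 2 / c * (g (v n) - g (v (Suc n)))) \<longlonglongrightarrow> 2 / c * (l - l)"
    by (intro tendsto_intros LIMSEQ_Suc)
  then have "(\<lambda>n. 2 / c * (g (v n) - g (v (Suc n)))) \<longlonglongrightarrow> 0" by simp
  moreover have "(norm (v (Suc n) - v n))\<^sup>2 \<le> 2 / c * (g (v n) - g (v (Suc n)))" for n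
    using desc[of n] c(1) by (simp add: field_simps)
  then have "\<forall>\<^sub>F n in sequentially. norm ((norm (v (Suc n) - v n))\<^sup>2) \<le> 2 / c * (g (v n) - g (v (Suc n)))"
    by simp
  ultimately have "(\<lambda>n. (norm (v (Suc n) - v n))\<^sup>2) \<longlonglongrightarrow> 0"
    by (rule Lim_null_comparison[rotated])
  then show ?thesis by (simp add: v_def tendsto_norm_zero_iff)
qed

text \<open>Telescoping. For \<open>j < L\<close> it shows that the parameters within one sweep
  represent asymptotically the same tensor.\<close>

lemma U_x_diff_add: "(\<lambda>n. U (x (n + j)) - U (x n)) \<longlonglongrightarrow> 0"
proof (induction j)
  case (Suc j)
  have "(\<lambda>n. (U (x (Suc (n + j))) - U (x (n + j))) + (U (x (n + j)) - U (x n))) \<longlonglongrightarrow> 0 + 0"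
    using LIMSEQ_ignore_initial_segment[OF U_x_diff, of j] Suc by (intro tendsto_add) auto
  then show ?case by simp
qed simp

section \<open>Accumulation points of minimal norm\<close>

text \<open>Accumulation points are taken along all micro-steps, not along one index set as in
  \<open>Ap_set\<close>. Thus minimality of norm does not depend on the subsequence, which changes
  from slot to slot.\<close>

definition cluster :: "'v \<Rightarrow> (nat \<Rightarrow> 'p) set" where
  "cluster w = {c \<in> P. U c = w \<and> (\<exists>r. strict_mono r \<and> (\<lambda>n. x (r n)) \<longlonglongrightarrow> c)}"

lemma compact_cluster: "compact (cluster w)"
proof -
  obtain K where K: "compact K" "K \<subseteq> P" "\<And>n. x n \<in> K" using x_compact by blast
  have "closed (cluster w)"
    unfolding closed_sequential_limits
  proof (intro allI impI, elim conjE)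
    fix f c assume f: "\<forall>n. f n \<in> cluster w" "f \<longlonglongrightarrow> c"
    have c: "c \<in> P" using closed_sequentially[OF closed_param _ f(2)] f(1) by (auto simp: cluster_def)
    then have "(\<lambda>n. U (f n)) \<longlonglongrightarrow> U c" using f by (intro U_tendsto) (auto simp: cluster_def)
    then have "U c = w" using f(1) LIMSEQ_unique[OF _ tendsto_const] by (auto simp: cluster_def)
    moreover have "c \<in> closure (x ` {N..})" for N
      using closed_sequentially[OF closed_closure _ f(2), of "x ` {N..}"] f(1)
      by (auto simp: cluster_def subseq_limit_iff_closure)
    ultimately show "c \<in> cluster w" using c by (simp add: cluster_def subseq_limit_iff_closure)
  qed
  moreover have "cluster w \<subseteq> K"
  proof
    fix c assume "c \<in> cluster w"
    then obtain r where "(\<lambda>n. x (r n)) \<longlonglongrightarrow> c" by (auto simp: cluster_def)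
    then show "c \<in> K" by (rule closed_sequentially[OF compact_imp_closed[OF K(1)] K(3)])
  qed
  ultimately show ?thesis using K(1) by (metis compact_Int_closed inf.absorb2)
qed

text \<open>The residue of the index modulo \<open>L\<close> tells which slot is updated next. The
  first conclusion keeps \<open>c\<close> and advances the residue by one, so it can be iterated
  through a sweep.\<close>

lemma min_cluster_step:
  assumes c: "c \<in> cluster w" and min: "\<And>d. d \<in> cluster w \<Longrightarrow> pnorm L c \<le> pnorm L d"
    and r: "strict_mono r" "(\<lambda>n. x (r n)) \<longlonglongrightarrow> c" and m: "\<And>n. r n mod L = m"
  shows "\<exists>r'. strict_mono r' \<and> (\<lambda>n. x (r' n)) \<longlonglongrightarrow> c \<and> (\<forall>n. r' n mod L = Suc m mod L)"
    and "z \<in> S (Suc m) \<Longrightarrow> Wmap U (Suc m) c z \<bullet> (A w - b) = 0"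
proof -
  define \<mu> where "\<mu> = Suc m"
  have \<mu>: "\<mu> \<in> {1..L}" using idx_in[of "r 0"] m by (simp add: \<mu>_def)
  then have mL: "m < L" by (simp add: \<mu>_def)
  have cP: "c \<in> P" and Uc: "U c = w" using c by (auto simp: cluster_def)
  obtain c' s where s: "strict_mono s" "(\<lambda>n. x (Suc (r (s n)))) \<longlonglongrightarrow> c'" and c'P: "c' \<in> P"
    by (rule x_subseq_limit[of "\<lambda>n. Suc (r n)"])
  define t where "t n = r (s n)" for n
  have t: "strict_mono t" "(\<lambda>n. x (t n)) \<longlonglongrightarrow> c" "(\<lambda>n. x (Suc (t n))) \<longlonglongrightarrow> c'"
    using r s LIMSEQ_subseq_LIMSEQ[OF r(2) s(1)]
    by (auto simp: t_def comp_def strict_mono_def)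
  have tm: "t n mod L = m" for n using m by (simp add: t_def)
  have Ut: "(\<lambda>n. U (x (t n))) \<longlonglongrightarrow> w" using U_x_tendsto[OF cP t(2)] Uc by simp
  have along_t: "(\<lambda>n. f (t n)) \<longlonglongrightarrow> l" if "f \<longlonglongrightarrow> l" for f and l :: 'v
    using LIMSEQ_subseq_LIMSEQ[OF that t(1)] by (simp add: comp_def)
  have Ut': "(\<lambda>n. U (x (Suc (t n)))) \<longlonglongrightarrow> w"
    using tendsto_add[OF along_t[OF U_x_diff] Ut] by simp
  have Uc': "U c' = w" using LIMSEQ_unique[OF U_x_tendsto[OF c'P t(3)] Ut'] .
  have mono': "strict_mono (\<lambda>n. Suc (t n))" using t(1) by (simp add: strict_mono_def)
  have c': "c' \<in> cluster w" using c'P Uc' mono' t(3) by (auto simp: cluster_def)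
  have Wlim: "(\<lambda>n. Wmap U \<mu> (x (t n)) z) \<longlonglongrightarrow> Wmap U \<mu> c z" if "z \<in> S \<mu>" for z
    unfolding Wmap_def using t(2) cP x_P \<mu> that
    by (intro U_tendsto param_upd) (auto simp: tendsto_fun_iff)
  have "bounded_linear A" using A by (simp add: linear_conv_bounded_linear)
  then have "(\<lambda>n. A (U (x (Suc (t n))))) \<longlonglongrightarrow> A w" using Ut' by (rule bounded_linear.tendsto)
  then have "(\<lambda>n. Wmap U \<mu> (x (t n)) z \<bullet> (A (U (x (Suc (t n)))) - b)) \<longlonglongrightarrow> Wmap U \<mu> c z \<bullet> (A w - b)"
    if "z \<in> S \<mu>" for z using Wlim[OF that] by (intro tendsto_intros)
  moreover have "Wmap U \<mu> (x (t n)) z \<bullet> (A (U (x (Suc (t n)))) - b) = 0" if "z \<in> S \<mu>" for z n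
    using x_step(3)[of z "t n"] that tm by (simp add: \<mu>_def)
  ultimately show "Wmap U (Suc m) c z \<bullet> (A w - b) = 0" if "z \<in> S (Suc m)"
    using that LIMSEQ_unique[OF _ tendsto_const] unfolding \<mu>_def by fastforce

  define \<kappa> where "\<kappa> n = t n div L" for n
  have t\<kappa>: "t n = \<kappa> n * L + m" for n using tm[of n] div_mult_mod_eq[of "t n" L] by (simp add: \<kappa>_def)
  have \<kappa>: "strict_mono \<kappa>" using t(1) unfolding strict_mono_def t\<kappa> by simp
  \<comment> \<open>The sweeps visited by \<open>t\<close>. The successor appears because ALS sweeps
    are numbered from 1, quotients by \<open>L\<close> from 0.\<close>
  define J where "J = range (\<lambda>n. Suc (\<kappa> n))"
  have J: "infinite J" "J \<subseteq> {1..}"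
    using \<kappa> by (auto simp: J_def strict_mono_def intro!: range_inj_infinite inj_onI) 
       (metis less_irrefl linorder_neqE_nat)
  have cAp: "c \<in> Ap_set L S pk J"
  proof -
    have "(\<lambda>n. pnorm L (\<lambda>\<nu>. x (t n) \<nu> - c \<nu>)) \<longlonglongrightarrow> 0"
      using t(2) param_out[OF x_P] param_out[OF cP] by (subst pnorm_tendsto_0_iff) auto
    then have lim: "\<forall>\<^sub>F n in sequentially. pnorm L (\<lambda>\<nu>. als_mix pk (Suc (\<kappa> n)) m \<nu> - c \<nu>) < e" if "e > 0" for e
      using that mL by (auto simp: t\<kappa> x_mult_add dest: order_tendstoD(2))
    have "infinite {k \<in> J. pnorm L (\<lambda>\<nu>. als_mix pk k m \<nu> - c \<nu>) < e}" if e: "e > 0" for e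
    proof -
      obtain N where N: "\<And>n. n \<ge> N \<Longrightarrow> pnorm L (\<lambda>\<nu>. als_mix pk (Suc (\<kappa> n)) m \<nu> - c \<nu>) < e"
        using lim[OF e] by (auto simp: eventually_sequentially)
      have "infinite ((\<lambda>n. Suc (\<kappa> n)) ` {N..})"
        using strict_mono_on_imp_inj_on[OF \<kappa>] infinite_Ici[of N]
        by (subst finite_image_iff) (auto simp: inj_on_def)
      moreover have "(\<lambda>n. Suc (\<kappa> n)) ` {N..} \<subseteq> {k \<in> J. pnorm L (\<lambda>\<nu>. als_mix pk k m \<nu> - c \<nu>) < e}"
        using N by (auto simp: J_def)
      ultimately show ?thesis using infinite_super by blast
    qed
    then have "acc_point_on L J (\<lambda>k. als_mix pk k m) c" by (simp add: acc_point_on_def)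
    moreover have "m \<in> {0..<L}" using mL by simp
    ultimately show ?thesis using cP unfolding Ap_set_def by blast
  qed
  \<comment> \<open>Every competitor in \<open>Ap_set L S pk J\<close> comes from the same sweeps as
    \<open>c\<close>, up to a shift within the sweep, so it represents \<open>w\<close> as well.
    Minimality of \<open>c\<close> in \<open>cluster w\<close> therefore implies the minimality that
    the rank assumption demands.\<close>
  have Ap_cluster: "d \<in> cluster w" if d: "d \<in> Ap_set L S pk J" for d
  proof -
    obtain j where j: "j < L" and dP: "d \<in> P" and acc: "acc_point_on L J (\<lambda>k. als_mix pk k j) d"
      using d by (auto simp: Ap_set_def)
    have "\<exists>\<^sub>F n in sequentially. dist (pnorm L (\<lambda>\<nu>. x (\<kappa> n * L + j) \<nu> - d \<nu>)) 0 < e" if "e > 0" for e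
    proof -
      have "infinite {k \<in> J. pnorm L (\<lambda>\<nu>. als_mix pk k j \<nu> - d \<nu>) < e}"
        using acc that by (simp add: acc_point_on_def)
      also have "{k \<in> J. pnorm L (\<lambda>\<nu>. als_mix pk k j \<nu> - d \<nu>) < e}
          = (\<lambda>n. Suc (\<kappa> n)) ` {n. pnorm L (\<lambda>\<nu>. x (\<kappa> n * L + j) \<nu> - d \<nu>) < e}"
        using j by (auto simp: J_def x_mult_add)
      finally have "infinite {n. pnorm L (\<lambda>\<nu>. x (\<kappa> n * L + j) \<nu> - d \<nu>) < e}" by blast
      then show ?thesis
        by (simp add: frequently_cofinite[symmetric] cofinite_eq_sequentially pnorm_def sum_nonneg)
    qed
    then obtain a where a: "strict_mono a" "(\<lambda>n. pnorm L (\<lambda>\<nu>. x (\<kappa> (a n) * L + j) \<nu> - d \<nu>)) \<longlonglongrightarrow> 0"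
      by (rule frequently_close_imp_subseq)
    have lim: "(\<lambda>n. x (\<kappa> (a n) * L + j)) \<longlonglongrightarrow> d"
      using a(2) param_out[OF x_P] param_out[OF dP]
      by (subst (asm) pnorm_tendsto_0_iff) auto
    have \<kappa>a: "strict_mono (\<lambda>n. \<kappa> (a n) * L)" using \<kappa> a(1) L by (auto simp: strict_mono_def)
    have sub: "(\<lambda>n. f (\<kappa> (a n) * L)) \<longlonglongrightarrow> 0" if "f \<longlonglongrightarrow> 0" for f :: "nat \<Rightarrow> 'v"
      using LIMSEQ_subseq_LIMSEQ[OF that \<kappa>a] by (simp add: comp_def)
    have "(\<lambda>n. U (x (\<kappa> (a n) * L + j)) - U (x (\<kappa> (a n) * L + m))) \<longlonglongrightarrow> 0"
      using tendsto_diff[OF sub[OF U_x_diff_add[of j]] sub[OF U_x_diff_add[of m]]] by simp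
    moreover have "(\<lambda>n. U (x (\<kappa> (a n) * L + m))) \<longlonglongrightarrow> w"
      using LIMSEQ_subseq_LIMSEQ[OF Ut a(1)] by (simp add: comp_def t\<kappa>)
    ultimately have "(\<lambda>n. U (x (\<kappa> (a n) * L + j))) \<longlonglongrightarrow> 0 + w"
      using tendsto_add by fastforce
    then have "U d = w" using LIMSEQ_unique[OF U_x_tendsto[OF dP lim]] by simp
    moreover have "strict_mono (\<lambda>n. \<kappa> (a n) * L + j)" using \<kappa>a by (simp add: strict_mono_def)
    ultimately show ?thesis using dP lim unfolding cluster_def by blast
  qed
  obtain k0 where k0: "k0 \<in> J"
    "\<And>k. k \<in> J \<Longrightarrow> k \<ge> k0 \<Longrightarrow> dim (als_W U pk k \<mu> ` S \<mu>) = dim (Wmap U \<mu> c ` S \<mu>)"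
    using A2 J cAp Ap_cluster min \<mu> unfolding assumption_A2_def by meson
  have rank: "\<forall>\<^sub>F n in sequentially. dim (Wmap U \<mu> (x (t n)) ` S \<mu>) = dim (Wmap U \<mu> c ` S \<mu>)"
    unfolding eventually_sequentially
  proof (intro exI allI impI)
    \<comment> \<open>The sweep threshold \<open>k0\<close> also serves as a sequence threshold,
      because a strictly increasing \<open>\<kappa>\<close> satisfies
      \<open>n \<le> \<kappa> n\<close>.\<close>
    fix n assume "k0 \<le> n"
    then have "k0 \<le> Suc (\<kappa> n)" using seq_suble[OF \<kappa>, of n] by simp
    moreover have "als_W U pk (Suc (\<kappa> n)) \<mu> = Wmap U \<mu> (x (t n))"
      using mL by (simp add: als_W_def t\<kappa> x_mult_add \<mu>_def)
    ultimately show "dim (Wmap U \<mu> (x (t n)) ` S \<mu>) = dim (Wmap U \<mu> c ` S \<mu>)"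
      using k0(2)[of "Suc (\<kappa> n)"] by (simp add: J_def)
  qed
  have lim\<mu>: "(\<lambda>n. x (Suc (t n)) \<mu>) \<longlonglongrightarrow> c' \<mu>" using t(3) by (simp add: tendsto_fun_iff)
  have orth: "c' \<mu> \<bullet> z = 0" if "z \<in> S \<mu>" "Wmap U \<mu> c z = 0" for z
  proof (rule kernel_orthogonal_limit[OF subspace_S[OF \<mu>] lin[OF x_P \<mu>] lin[OF cP \<mu>] Wlim rank lim\<mu> _ that])
    show "x (Suc (t n)) \<mu> \<bullet> z = 0" if "z \<in> S \<mu>" "Wmap U \<mu> (x (t n)) z = 0" for n z
      using x_step(4)[of z "t n"] that tm by (simp add: \<mu>_def)
  qed
  have off: "c' \<nu> = c \<nu>" if "\<nu> \<noteq> \<mu>" for \<nu>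
  proof -
    have "(\<lambda>n. x (Suc (t n)) \<nu>) = (\<lambda>n. x (t n) \<nu>)" using that by (simp add: x_Suc tm \<mu>_def)
    moreover have "(\<lambda>n. x (Suc (t n)) \<nu>) \<longlonglongrightarrow> c' \<nu>" "(\<lambda>n. x (t n) \<nu>) \<longlonglongrightarrow> c \<nu>"
      using t(2,3) by (simp_all add: tendsto_fun_iff)
    ultimately show ?thesis using LIMSEQ_unique by metis
  qed
  then have c'_upd: "c' = c(\<mu> := c' \<mu>)" by auto
  have "Wmap U \<mu> c (c' \<mu>) = w" using Uc' c'_upd by (simp add: Wmap_def)
  moreover have "Wmap U \<mu> c (c \<mu>) = w" using Uc by (simp add: Wmap_def)
  moreover have "c \<mu> \<in> S \<mu>" "c' \<mu> \<in> S \<mu>" using param_in cP c'P \<mu> by auto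
  ultimately have "c \<mu> - c' \<mu> \<in> S \<mu>" "Wmap U \<mu> c (c \<mu> - c' \<mu>) = 0"
    using lin_on_diff[OF subspace_S[OF \<mu>] lin[OF cP \<mu>]] subspace_diff[OF subspace_S[OF \<mu>]] by auto
  then have "c' \<mu> \<bullet> (c \<mu> - c' \<mu>) = 0" by (rule orth)
  \<comment> \<open>\<open>c\<close> and \<open>c'\<close> differ only in slot \<open>\<mu>\<close>,
    so minimality of \<open>c\<close> compares the norms of this slot alone and forces the last
    summand to vanish.\<close>
  then have pyth: "(norm (c \<mu>))\<^sup>2 = (norm (c' \<mu>))\<^sup>2 + (norm (c \<mu> - c' \<mu>))\<^sup>2"
    by (simp add: power2_norm_eq_inner inner_diff_left inner_diff_right inner_commute)
  have "pnorm L c \<le> pnorm L c'" using min[OF c'] .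
  then have "(\<Sum>\<nu>\<in>{1..L}. (norm (c \<nu>))\<^sup>2) \<le> (\<Sum>\<nu>\<in>{1..L}. (norm (c' \<nu>))\<^sup>2)"
    by (simp add: pnorm_def)
  moreover have "(\<Sum>\<nu>\<in>{1..L} - {\<mu>}. (norm (c \<nu>))\<^sup>2) = (\<Sum>\<nu>\<in>{1..L} - {\<mu>}. (norm (c' \<nu>))\<^sup>2)"
    by (rule sum.cong) (use off in auto)
  ultimately have "(norm (c \<mu>))\<^sup>2 \<le> (norm (c' \<mu>))\<^sup>2"
    using sum.remove[OF finite_atLeastAtMost \<mu>, of "\<lambda>\<nu>. (norm (c \<nu>))\<^sup>2"] sum.remove[OF finite_atLeastAtMost \<mu>, of "\<lambda>\<nu>. (norm (c' \<nu>))\<^sup>2"]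
    by linarith
  then have "c \<mu> = c' \<mu>" using pyth by simp
  then have "c' = c" using c'_upd by (metis fun_upd_triv)
  moreover have "Suc (t n) mod L = Suc m mod L" for n using tm[of n] by (metis mod_Suc_eq)
  ultimately show "\<exists>r'. strict_mono r' \<and> (\<lambda>n. x (r' n)) \<longlonglongrightarrow> c \<and> (\<forall>n. r' n mod L = Suc m mod L)"
    using mono' t(3) by blast
qed

text \<open>By the pigeonhole principle some residue occurs infinitely often along a subsequence
  converging to \<open>c\<close>. From there the residue is advanced until slot \<open>\<mu>\<close>
  is the next one to be updated.\<close>

lemma min_cluster_normal_equation:
  assumes c: "c \<in> cluster w" and min: "\<And>d. d \<in> cluster w \<Longrightarrow> pnorm L c \<le> pnorm L d"
    and \<mu>: "\<mu> \<in> {1..L}" and z: "z \<in> S \<mu>"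
  shows "Wmap U \<mu> c z \<bullet> (A w - b) = 0"
proof -
  obtain r where r: "strict_mono r" "(\<lambda>n. x (r n)) \<longlonglongrightarrow> c" using c by (auto simp: cluster_def)
  have "finite (range (\<lambda>n. r n mod L))"
    by (rule finite_subset[of _ "{..<L}"]) (use L in auto)
  then obtain m where m: "infinite {n. r n mod L = m}"
    using inf_img_fin_dom[of "\<lambda>n. r n mod L" UNIV] by (auto simp: vimage_def)
  define s where "s = enumerate {n. r n mod L = m}"
  have s: "strict_mono s" "r (s n) mod L = m" for n
    using m enumerate_in_set[OF m] strict_mono_enumerate[OF m] by (auto simp: s_def)
  have "\<exists>r'. strict_mono r' \<and> (\<lambda>n. x (r' n)) \<longlonglongrightarrow> c \<and> (\<forall>n. r' n mod L = (m + j) mod L)" for j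
  proof (induction j)
    case 0
    have "m mod L = m" using s(2)[of 0] by (metis mod_mod_trivial)
    moreover have "strict_mono (\<lambda>n. r (s n))" using r(1) s(1) by (simp add: strict_mono_def)
    ultimately show ?case using LIMSEQ_subseq_LIMSEQ[OF r(2) s(1)] s(2)
      by (intro exI[of _ "\<lambda>n. r (s n)"]) (auto simp: comp_def)
  next
    case (Suc j)
    then obtain r' where "strict_mono r'" "(\<lambda>n. x (r' n)) \<longlonglongrightarrow> c" "\<And>n. r' n mod L = (m + j) mod L" by blast
    from min_cluster_step(1)[OF c min this] show ?case by (simp add: mod_Suc_eq)
  qed
  \<comment> \<open>\<open>L - m mod L\<close> steps lead to residue 0, and \<open>\<mu> - 1\<close>
    further steps to the residue preceding the update of slot \<open>\<mu>\<close>.\<close>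
  then obtain r' where r': "strict_mono r'" "(\<lambda>n. x (r' n)) \<longlonglongrightarrow> c"
    "\<And>n. r' n mod L = (m + ((\<mu> - 1) + (L - m mod L))) mod L" by blast
  have "(m + ((\<mu> - 1) + (L - m mod L))) mod L = \<mu> - 1"
  proof -
    have "m mod L < L" using L by simp
    then have "m + ((\<mu> - 1) + (L - m mod L)) = (\<mu> - 1) + (m div L + 1) * L"
      using div_mult_mod_eq[of m L] unfolding add_mult_distrib by linarith
    then have "(m + ((\<mu> - 1) + (L - m mod L))) mod L = (\<mu> - 1) mod L" by (metis mod_mult_self1)
    moreover have "\<mu> - 1 < L" using \<mu> by auto
    ultimately show ?thesis by simp
  qed
  with min_cluster_step(2)[OF c min r'(1,2), of "\<mu> - 1" z] r'(3) \<mu> z show ?thesis by simp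
qed

section \<open>Critical limits and convergence of the distance\<close>

lemma pk_eq_x: "k \<ge> 1 \<Longrightarrow> pk k = x ((k - 1) * L)"
  using x_mult_add[of 0 "k - 1"] L by (auto simp: als_mix_def)

lemma accumulation_point_critical:
  assumes r: "strict_mono r" "(\<lambda>k. U (pk (r k))) \<longlonglongrightarrow> w"
  shows "w \<in> crit_set L S U A b"
proof -
  \<comment> \<open>The shift by one ensures \<open>r (Suc n) \<ge> 1\<close>; \<open>pk 0\<close>
    is not an ALS iterate and may be arbitrary.\<close>
  define f where "f n = (r (Suc n) - 1) * L" for n
  have r1: "r (Suc n) \<ge> 1" for n using seq_suble[OF r(1), of "Suc n"] by simp
  have f: "strict_mono f"
  proof (rule strict_monoI)
    fix m n :: nat assume "m < n"
    then have "r (Suc m) < r (Suc n)" using r(1) by (simp add: strict_mono_def)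
    then show "f m < f n" using r1[of m] L by (simp add: f_def)
  qed
  have lim: "(\<lambda>n. U (x (f n))) \<longlonglongrightarrow> w"
    using LIMSEQ_Suc[OF r(2)] pk_eq_x[OF r1] by (simp add: f_def)
  obtain c s where s: "strict_mono s" "(\<lambda>n. x (f (s n))) \<longlonglongrightarrow> c" "c \<in> P" by (rule x_subseq_limit)
  have "U c = w"
    using LIMSEQ_unique[OF U_x_tendsto[OF s(3,2)]] LIMSEQ_subseq_LIMSEQ[OF lim s(1)] by (simp add: comp_def)
  moreover have "strict_mono (\<lambda>n. f (s n))" using f s(1) by (simp add: strict_mono_def)
  ultimately have ne: "cluster w \<noteq> {}" using s by (auto simp: cluster_def)
  obtain c where c: "c \<in> cluster w" "\<And>d. d \<in> cluster w \<Longrightarrow> pnorm L c \<le> pnorm L d"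
    using continuous_attains_inf[OF compact_cluster ne continuous_on_pnorm] by blast
  then have cP: "c \<in> P" and Uc: "U c = w" by (auto simp: cluster_def)
  have "is_crit L S U A b c"
    using min_cluster_normal_equation[OF c] Uc by (intro is_crit_normal_equations A A_sym cP) simp
  then show ?thesis using cP Uc by (auto simp: crit_set_def)
qed

text \<open>A subsequence staying at distance at least \<open>e\<close> would, by compactness of the
  parameters, have a further subsequence with convergent tensors, whose limit is critical. The
  convention that \<open>infdist\<close> to the empty set is 0 does no harm: the same compactness
  provides an accumulation point, hence a critical tensor.\<close>

lemma infdist_crit_set_tendsto_0: "(\<lambda>k. infdist (U (pk k)) (crit_set L S U A b)) \<longlonglongrightarrow> 0"
proof (rule ccontr)
  let ?M = "crit_set L S U A b"
  assume "\<not> (\<lambda>k. infdist (U (pk k)) ?M) \<longlonglongrightarrow> 0"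
  then have "\<exists>e>0. \<forall>N. \<exists>n\<ge>N. infdist (U (pk n)) ?M \<ge> e"
    by (simp add: LIMSEQ_iff infdist_nonneg not_less)
  then obtain e where e: "e > 0" "\<And>N. \<exists>n\<ge>N. infdist (U (pk n)) ?M \<ge> e" by blast
  have "infinite {n. infdist (U (pk n)) ?M \<ge> e}"
    unfolding infinite_nat_iff_unbounded_le using e(2) by auto
  then obtain r :: "nat \<Rightarrow> nat" where r: "strict_mono r" "\<And>n. infdist (U (pk (r n))) ?M \<ge> e"
    using infinite_enumerate by (metis mem_Collect_eq)
  have r1: "r (Suc n) \<ge> 1" for n using seq_suble[OF r(1), of "Suc n"] by simp
  obtain c s where s: "strict_mono s" "(\<lambda>n. x ((r (Suc (s n)) - 1) * L)) \<longlonglongrightarrow> c" "c \<in> P"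
    by (rule x_subseq_limit[of "\<lambda>n. (r (Suc n) - 1) * L"])
  have lim: "(\<lambda>n. U (pk (r (Suc (s n))))) \<longlonglongrightarrow> U c"
    using U_x_tendsto[OF s(3,2)] pk_eq_x[OF r1] by simp
  have "strict_mono (\<lambda>n. r (Suc (s n)))" using r(1) s(1) by (simp add: strict_mono_def)
  then have "U c \<in> ?M" using lim by (rule accumulation_point_critical)
  then have "infdist (U c) ?M = 0" by simp
  moreover have "(\<lambda>n. infdist (U (pk (r (Suc (s n))))) ?M) \<longlonglongrightarrow> infdist (U c) ?M"
    using lim by (rule tendsto_infdist)
  then have "e \<le> infdist (U c) ?M" using r(2) by (intro LIMSEQ_le_const) auto
  ultimately show False using e(1) by simp
qed

end

theorem mainTheorem1:
  fixes A :: "'v::euclidean_space \<Rightarrow> 'v" and b :: 'v and L :: nat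
    and S :: "nat \<Rightarrow> 'p::euclidean_space set" and U :: "(nat \<Rightarrow> 'p) \<Rightarrow> 'v"
    and pk :: "nat \<Rightarrow> nat \<Rightarrow> 'p"
  assumes "L \<ge> 1"
    and "linear A" and "\<forall>x y. A x \<bullet> y = x \<bullet> A y" and "\<forall>x. x \<noteq> 0 \<longrightarrow> A x \<bullet> x > 0"
    and "b \<noteq> 0"
    and "\<forall>\<mu>\<in>{1..L}. subspace (S \<mu>)"
    and "\<forall>p\<in>param_space L S. \<forall>\<mu>\<in>{1..L}. lin_on (S \<mu>) (Wmap U \<mu> p)"
    and "is_ALS_seq L S U A b pk"
    and "assumption_A2 L S U pk"
  shows "(\<forall>w. (\<exists>r. strict_mono r \<and> ((\<lambda>k. U (pk (r k))) \<longlonglongrightarrow> w)) \<longrightarrow> w \<in> crit_set L S U A b)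
       \<and> ((\<lambda>k. infdist (U (pk k)) (crit_set L S U A b)) \<longlonglongrightarrow> 0)"
proof -
  interpret als_sequence L S U A b pk
    by unfold_locales (use assms in \<open>simp_all add: linear_add linear_scale\<close>)
  show ?thesis using accumulation_point_critical infdist_crit_set_tendsto_0 by blast
qed

end
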